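(* Let $I$ be a closed ideal in a pseudocompact topological $MV$-algebra $A$ and let $\iota_1:A\hookrightarrow\beta A$ be the canonical embedding into the Stone-Čech compactification. Then $\operatorname{cl}_{\beta A}\iota_1(I)$ is a closed ideal of $\beta A$, and $$\beta A/\operatorname{cl}_{\beta A}\iota_1(I)\;\cong\;\beta(A/I)$$ as topological $MV$-algebras.
   Context: An $MV$-algebra is an algebra $(A,\oplus,{}^*,0)$ of type $(2,1,0)$ such that $(A,\oplus,0)$ is a commutative monoid, $x^{**}=x$, $x\oplus 0^*=0^*$ and $(x^*\oplus y)^*\oplus y=(y^*\oplus x)^*\oplus x$ for all $x,y$. One writes $1=0^*$, $x\odot y=(x^*\oplus y^* )^*$, $x\ominus y=x\odot y^*$, and $x\le y$ iff $x^*\oplus y=1$. A topological $MV$-algebra is an $MV$-algebra equipped with a topology such that $\oplus$ and ${}^*$ are continuous. All spaces (in particular underlying spaces of topological $MV$-algebras) are assumed to be Tychonoff. A Tychonoff space is pseudocompact if every continuous real-valued function on it is bounded. An ideal of $A$ is a subset $I$ with $0\in I$, closed under $\oplus$, and such that $y\le x\in I$ implies $y\in I$. The quotient $MV$-algebra $A/I$ is the quotient by the congruence $x\equiv_I y\iff (x\ominus y)\oplus(y\ominus x)\in I$; quotients carry the quotient topology. For a pseudocompact topological $MV$-algebra $X$, the Stone-Čech compactification $\beta X$ is regarded as a compact topological $MV$-algebra whose operations are the unique continuous extensions of the operations of $X$. Here $\beta(A/I)$ is understood in this sense, $A/I$ with the quotient topology being a (Tychonoff) pseudocompact topological $MV$-algebra.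 *)

theory Defs
  imports "HOL-Analysis.Analysis"
begin

section \<open>MV-algebras\<close>

record 'a mv =
  carr :: "'a set"
  plus :: "'a \<Rightarrow> 'a \<Rightarrow> 'a"
  star :: "'a \<Rightarrow> 'a"
  zero :: 'a

definition MV_algebra :: "('a, 'm) mv_scheme \<Rightarrow> bool" where
  "MV_algebra A \<longleftrightarrow>
     zero A \<in> carr A \<and>
     (\<forall>x\<in>carr A. star A x \<in> carr A) \<and>
     (\<forall>x\<in>carr A. \<forall>y\<in>carr A. plus A x y \<in> carr A) \<and>
     (\<forall>x\<in>carr A. \<forall>y\<in>carr A. \<forall>z\<in>carr A.
        plus A (plus A x y) z = plus A x (plus A y z)) \<and>
     (\<forall>x\<in>carr A. \<forall>y\<in>carr A. plus A x y = plus A y x) \<and>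
     (\<forall>x\<in>carr A. plus A x (zero A) = x) \<and>
     (\<forall>x\<in>carr A. star A (star A x) = x) \<and>
     (\<forall>x\<in>carr A. plus A x (star A (zero A)) = star A (zero A)) \<and>
     (\<forall>x\<in>carr A. \<forall>y\<in>carr A.
        plus A (star A (plus A (star A x) y)) y = plus A (star A (plus A (star A y) x)) x)"

definition one :: "('a, 'm) mv_scheme \<Rightarrow> 'a" where
  "one A = star A (zero A)"

definition odot :: "('a, 'm) mv_scheme \<Rightarrow> 'a \<Rightarrow> 'a \<Rightarrow> 'a" where
  "odot A x y = star A (plus A (star A x) (star A y))"

definition ominus :: "('a, 'm) mv_scheme \<Rightarrow> 'a \<Rightarrow> 'a \<Rightarrow> 'a" where
  "ominus A x y = odot A x (star A y)"

definition mv_le :: "('a, 'm) mv_scheme \<Rightarrow> 'a \<Rightarrow> 'a \<Rightarrow> bool" where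
  "mv_le A x y \<longleftrightarrow> plus A (star A x) y = one A"

definition mv_ideal :: "('a, 'm) mv_scheme \<Rightarrow> 'a set \<Rightarrow> bool" where
  "mv_ideal A I \<longleftrightarrow>
     I \<subseteq> carr A \<and> zero A \<in> I \<and>
     (\<forall>x\<in>I. \<forall>y\<in>I. plus A x y \<in> I) \<and>
     (\<forall>x\<in>I. \<forall>y\<in>carr A. mv_le A y x \<longrightarrow> y \<in> I)"

definition mv_cong :: "('a, 'm) mv_scheme \<Rightarrow> 'a set \<Rightarrow> ('a \<times> 'a) set" where
  "mv_cong A I = {(x, y). x \<in> carr A \<and> y \<in> carr A \<and>
     plus A (ominus A x y) (ominus A y x) \<in> I}"

definition mv_class :: "('a, 'm) mv_scheme \<Rightarrow> 'a set \<Rightarrow> 'a \<Rightarrow> 'a set" where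
  "mv_class A I x = mv_cong A I `` {x}"

definition mv_hom :: "('a, 'm) mv_scheme \<Rightarrow> ('b, 'n) mv_scheme \<Rightarrow> ('a \<Rightarrow> 'b) \<Rightarrow> bool" where
  "mv_hom A B h \<longleftrightarrow>
     h ` carr A \<subseteq> carr B \<and>
     h (zero A) = zero B \<and>
     (\<forall>x\<in>carr A. h (star A x) = star B (h x)) \<and>
     (\<forall>x\<in>carr A. \<forall>y\<in>carr A. h (plus A x y) = plus B (h x) (h y))"

section \<open>Topological MV-algebras\<close>

record 'a top_mv = "'a mv" +
  top_of :: "'a topology"

definition Tychonoff_space :: "'a topology \<Rightarrow> bool" where
  "Tychonoff_space X \<longleftrightarrow> completely_regular_space X \<and> Hausdorff_space X"

definition pseudocompact_space :: "'a topology \<Rightarrow> bool" where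
  "pseudocompact_space X \<longleftrightarrow> Tychonoff_space X \<and>
     (\<forall>f. continuous_map X euclideanreal f \<longrightarrow> bounded (f ` topspace X))"

definition topological_MV :: "'a top_mv \<Rightarrow> bool" where
  "topological_MV A \<longleftrightarrow>
     MV_algebra A \<and> topspace (top_of A) = carr A \<and> Tychonoff_space (top_of A) \<and>
     continuous_map (prod_topology (top_of A) (top_of A)) (top_of A) (\<lambda>(x, y). plus A x y) \<and>
     continuous_map (top_of A) (top_of A) (star A)"

definition top_mv_iso :: "'a top_mv \<Rightarrow> 'b top_mv \<Rightarrow> bool" where
  "top_mv_iso A B \<longleftrightarrow>
     topological_MV A \<and> topological_MV B \<and>
     (\<exists>h. mv_hom A B h \<and> homeomorphic_map (top_of A) (top_of B) h)"

definition quotient_topology :: "'a topology \<Rightarrow> ('a \<Rightarrow> 'b) \<Rightarrow> 'b topology" where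
  "quotient_topology X q =
     topology (\<lambda>U. U \<subseteq> q ` topspace X \<and> openin X {x \<in> topspace X. q x \<in> U})"

lemma istopology_quotient:
  "istopology (\<lambda>U. U \<subseteq> q ` topspace X \<and> openin X {x \<in> topspace X. q x \<in> U})"
proof -
  have 1: "openin X {x \<in> topspace X. q x \<in> S \<inter> T}"
    if "openin X {x \<in> topspace X. q x \<in> S}" "openin X {x \<in> topspace X. q x \<in> T}" for S T
  proof -
    have "{x \<in> topspace X. q x \<in> S \<inter> T} =
        {x \<in> topspace X. q x \<in> S} \<inter> {x \<in> topspace X. q x \<in> T}"
      by auto
    then show ?thesis using that by (simp only: openin_Int)
  qed
  have 2: "openin X {x \<in> topspace X. q x \<in> \<Union>\<K>}"
    if "\<And>K. K \<in> \<K> \<Longrightarrow> openin X {x \<in> topspace X. q x \<in> K}" for \<K>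
  proof -
    have "{x \<in> topspace X. q x \<in> \<Union>\<K>} = (\<Union>K\<in>\<K>. {x \<in> topspace X. q x \<in> K})"
      by auto
    then show ?thesis using that by auto
  qed
  show ?thesis
    unfolding istopology_def using 1 2 by blast
qed

lemma openin_quotient_topology:
  "openin (quotient_topology X q) U \<longleftrightarrow>
     U \<subseteq> q ` topspace X \<and> openin X {x \<in> topspace X. q x \<in> U}"
  unfolding quotient_topology_def by (simp add: topology_inverse'[OF istopology_quotient])

lemma topspace_quotient_topology: "topspace (quotient_topology X q) = q ` topspace X"
proof
  show "topspace (quotient_topology X q) \<subseteq> q ` topspace X"
    by (metis openin_quotient_topology openin_topspace)
  have "{x \<in> topspace X. q x \<in> q ` topspace X} = topspace X"
    by auto
  then show "q ` topspace X \<subseteq> topspace (quotient_topology X q)"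
    by (intro openin_subset) (simp add: openin_quotient_topology)
qed

lemma quotient_map_quotient_topology: "quotient_map X (quotient_topology X q) q"
  unfolding quotient_map_def
  by (simp add: topspace_quotient_topology openin_quotient_topology)

text \<open>The operations on classes are unions over all representatives; each such union is a
  single class because \<^const>\<open>mv_cong\<close> is a congruence when \<open>I\<close> is an ideal.\<close>

definition mv_quotient :: "'a top_mv \<Rightarrow> 'a set \<Rightarrow> 'a set top_mv" where
  "mv_quotient A I =
     \<lparr> carr = carr A // mv_cong A I,
       plus = (\<lambda>P Q. \<Union>x\<in>P. \<Union>y\<in>Q. mv_class A I (plus A x y)),
       star = (\<lambda>P. \<Union>x\<in>P. mv_class A I (star A x)),
       zero = mv_class A I (zero A),
       top_of = quotient_topology (top_of A) (mv_class A I) \<rparr>"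

section \<open>The Stone-Cech compactification\<close>

text \<open>The closure of the image of \<open>X\<close> under the evaluation map into the cube whose coordinates
  are the continuous functions from \<open>X\<close> to the unit interval. These functions are taken
  extensional so that each of them occurs exactly once as a coordinate.\<close>

definition unit_functions :: "'a topology \<Rightarrow> ('a \<Rightarrow> real) set" where
  "unit_functions X =
     {f \<in> extensional (topspace X). continuous_map X (top_of_set {0..1}) f}"

definition sc_cube :: "'a topology \<Rightarrow> (('a \<Rightarrow> real) \<Rightarrow> real) topology" where
  "sc_cube X = product_topology (\<lambda>_. top_of_set {0..1}) (unit_functions X)"

definition sc_emb :: "'a topology \<Rightarrow> 'a \<Rightarrow> ('a \<Rightarrow> real) \<Rightarrow> real" where
  "sc_emb X x = (\<lambda>f\<in>unit_functions X. f x)"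

definition stone_cech :: "'a topology \<Rightarrow> (('a \<Rightarrow> real) \<Rightarrow> real) topology" where
  "stone_cech X = subtopology (sc_cube X) (sc_cube X closure_of (sc_emb X ` topspace X))"

text \<open>\<open>B\<close> is the space \<open>\<beta>A\<close> with the continuous extensions of the operations of \<open>A\<close>. As \<open>A\<close> is dense
  in \<open>\<beta>A\<close>, these extensions are unique on the carrier. The MV-identities for \<open>B\<close> are not
  required here; they follow from those of \<open>A\<close> by density.\<close>

definition is_stone_cech_MV :: "'a top_mv \<Rightarrow> (('a \<Rightarrow> real) \<Rightarrow> real) top_mv \<Rightarrow> bool" where
  "is_stone_cech_MV A B \<longleftrightarrow>
     top_of B = stone_cech (top_of A) \<and>
     carr B = topspace (stone_cech (top_of A)) \<and>
     continuous_map (prod_topology (top_of B) (top_of B)) (top_of B) (\<lambda>(p, q). plus B p q) \<and>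
     continuous_map (top_of B) (top_of B) (star B) \<and>
     mv_hom A B (sc_emb (top_of A))"

end

theory Submission
  imports Defs
begin

text \<open>Write \<open>B = \<beta>A\<close> and let \<open>J\<close> be the closure of \<open>I\<close> in \<open>B\<close>. Two elements \<open>x, y\<close> of an MV-algebra are
  congruent modulo an ideal iff \<open>x = (y \<ominus> b) \<oplus> a\<close> with \<open>a, b\<close> in the ideal. Hence quotient maps by
  ideals are open, \<open>B/J\<close> is compact Hausdorff, and, approximating elements of \<open>J\<close> by elements of
  \<open>I\<close>, the map \<open>A/I \<rightarrow> B/J\<close> is a dense topological embedding; in particular \<open>A/I\<close> is Tychonoff.
  If \<open>f : A/I \<rightarrow> [0,1]\<close> is continuous and \<open>F\<close> is the extension of \<open>f \<circ> q\<close> to \<open>B\<close>, then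
  \<open>F ((x \<ominus> b) \<oplus> a) = F x\<close> holds on \<open>A \<times> I \<times> I\<close>, hence by density on \<open>B \<times> J \<times> J\<close>, so \<open>F\<close> factors
  through \<open>B/J\<close>. Thus \<open>B/J\<close> is the Stone-Cech compactification of \<open>A/I\<close>, and its operations are
  the continuous extensions of those of \<open>A/I\<close>.\<close>

section \<open>MV-algebras, ideals and congruences\<close>

locale mv_algebra =
  fixes A :: "('a, 'm) mv_scheme"
  assumes MV: "MV_algebra A"
begin

abbreviation mv_plus (infixl "\<boxplus>" 65) where "x \<boxplus> y \<equiv> plus A x y"
abbreviation mv_minus (infixl "\<boxminus>" 65) where "x \<boxminus> y \<equiv> ominus A x y"
abbreviation mv_star ("\<sim> _" [81] 80) where "\<sim> x \<equiv> star A x"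
abbreviation mv_one ("\<one>") where "\<one> \<equiv> one A"
abbreviation mv_zero ("\<zero>") where "\<zero> \<equiv> zero A"
abbreviation mv_leq (infix "\<sqsubseteq>" 50) where "x \<sqsubseteq> y \<equiv> mv_le A x y"

lemma zero_carr [simp]: "\<zero> \<in> carr A"
  and star_carr [simp]: "x \<in> carr A \<Longrightarrow> \<sim> x \<in> carr A"
  and plus_carr [simp]: "x \<in> carr A \<Longrightarrow> y \<in> carr A \<Longrightarrow> x \<boxplus> y \<in> carr A"
  using MV unfolding MV_algebra_def by meson+

lemma plus_assoc:
    "x \<in> carr A \<Longrightarrow> y \<in> carr A \<Longrightarrow> z \<in> carr A \<Longrightarrow> x \<boxplus> y \<boxplus> z = x \<boxplus> (y \<boxplus> z)"
  and plus_commute: "x \<in> carr A \<Longrightarrow> y \<in> carr A \<Longrightarrow> x \<boxplus> y = y \<boxplus> x"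
  and plus_zero [simp]: "x \<in> carr A \<Longrightarrow> x \<boxplus> \<zero> = x"
  and star_star [simp]: "x \<in> carr A \<Longrightarrow> \<sim> (\<sim> x) = x"
  and plus_one [simp]: "x \<in> carr A \<Longrightarrow> x \<boxplus> \<one> = \<one>"
  and lukasiewicz:
    "x \<in> carr A \<Longrightarrow> y \<in> carr A \<Longrightarrow> \<sim> (\<sim> x \<boxplus> y) \<boxplus> y = \<sim> (\<sim> y \<boxplus> x) \<boxplus> x"
  using MV unfolding MV_algebra_def one_def by meson+

lemma plus_left_commute:
  "x \<in> carr A \<Longrightarrow> y \<in> carr A \<Longrightarrow> z \<in> carr A \<Longrightarrow> x \<boxplus> (y \<boxplus> z) = y \<boxplus> (x \<boxplus> z)"
  by (metis plus_assoc plus_commute)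

lemmas plus_ac = plus_assoc plus_commute plus_left_commute

lemma one_carr [simp]: "\<one> \<in> carr A"
  unfolding one_def by simp

lemma star_zero [simp]: "\<sim> \<zero> = \<one>"
  by (simp add: one_def)

lemma star_one [simp]: "\<sim> \<one> = \<zero>"
  using star_star[OF zero_carr] by (simp only: star_zero)

lemma one_plus [simp]: "x \<in> carr A \<Longrightarrow> \<one> \<boxplus> x = \<one>"
  using plus_commute by force

lemma zero_plus [simp]: "x \<in> carr A \<Longrightarrow> \<zero> \<boxplus> x = x"
  using plus_commute by force

text \<open>Instance of \<open>lukasiewicz\<close> with second argument \<open>\<one>\<close>: one
  side collapses to \<open>\<one>\<close>, the other to the sum in question.\<close>

lemma star_plus_self [simp]: "x \<in> carr A \<Longrightarrow> \<sim> x \<boxplus> x = \<one>"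
  using lukasiewicz[of x \<one>] by simp

lemma ominus_eq: "x \<in> carr A \<Longrightarrow> y \<in> carr A \<Longrightarrow> x \<boxminus> y = \<sim> (\<sim> x \<boxplus> y)"
  by (simp add: ominus_def odot_def)

lemma ominus_carr [simp]: "x \<in> carr A \<Longrightarrow> y \<in> carr A \<Longrightarrow> x \<boxminus> y \<in> carr A"
  by (simp add: ominus_eq)

lemma le_refl: "x \<in> carr A \<Longrightarrow> x \<sqsubseteq> x"
  by (simp add: mv_le_def)

lemma le_plus: "x \<in> carr A \<Longrightarrow> y \<in> carr A \<Longrightarrow> x \<sqsubseteq> x \<boxplus> y"
  by (simp add: mv_le_def plus_assoc[symmetric])

lemma le_plus': "x \<in> carr A \<Longrightarrow> y \<in> carr A \<Longrightarrow> x \<sqsubseteq> y \<boxplus> x"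
  by (metis le_plus plus_commute)

text \<open>Both sides of \<open>lukasiewicz\<close> are the join of the two elements, which is
  \<open>y\<close> when \<open>x\<close> lies below \<open>y\<close>. Hence the order is the
  divisibility order of the monoid, and transitivity and monotonicity reduce to
  associativity.\<close>

lemma le_imp_plus_ominus:
  assumes "x \<in> carr A" "y \<in> carr A" "x \<sqsubseteq> y"
  shows "x \<boxplus> (y \<boxminus> x) = y"
proof -
  have "\<sim> (\<sim> y \<boxplus> x) \<boxplus> x = \<sim> (\<sim> x \<boxplus> y) \<boxplus> y"
    using assms lukasiewicz by blast
  also have "\<dots> = y"
    using assms by (simp add: mv_le_def)
  finally show ?thesis
    using assms by (simp add: ominus_eq plus_commute)
qed

lemma le_trans:
  assumes "x \<in> carr A" "y \<in> carr A" "z \<in> carr A" "x \<sqsubseteq> y" "y \<sqsubseteq> z"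
  shows "x \<sqsubseteq> z"
proof -
  have "\<sim> x \<boxplus> z = \<sim> x \<boxplus> y \<boxplus> (z \<boxminus> y)"
    using assms by (simp add: plus_assoc le_imp_plus_ominus)
  then show ?thesis
    using assms by (simp add: mv_le_def)
qed

lemma plus_mono_left:
  assumes "x \<in> carr A" "y \<in> carr A" "z \<in> carr A" "x \<sqsubseteq> y"
  shows "x \<boxplus> z \<sqsubseteq> y \<boxplus> z"
proof -
  define w where "w = y \<boxminus> x"
  have w: "w \<in> carr A" "y = x \<boxplus> w"
    using assms by (simp_all add: w_def le_imp_plus_ominus)
  have "y \<boxplus> z = x \<boxplus> z \<boxplus> w"
    using assms(1,3) w by (simp add: plus_assoc plus_commute[of w z])
  then show ?thesis
    using assms(1,3) w le_plus[of "x \<boxplus> z" w] by simp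
qed

lemma plus_mono:
  assumes "x \<in> carr A" "y \<in> carr A" "u \<in> carr A" "v \<in> carr A" "x \<sqsubseteq> y" "u \<sqsubseteq> v"
  shows "x \<boxplus> u \<sqsubseteq> y \<boxplus> v"
proof -
  have "x \<boxplus> u \<sqsubseteq> y \<boxplus> u" "u \<boxplus> y \<sqsubseteq> v \<boxplus> y"
    by (auto intro!: plus_mono_left assms)
  then show ?thesis
    using assms le_trans[of "x \<boxplus> u" "y \<boxplus> u" "y \<boxplus> v"] by (simp add: plus_commute)
qed

text \<open>Residuation: both inequalities unfold to the same equation in three variables.\<close>

lemma ominus_le_iff:
  assumes "x \<in> carr A" "y \<in> carr A" "z \<in> carr A"
  shows "x \<boxminus> y \<sqsubseteq> z \<longleftrightarrow> x \<sqsubseteq> y \<boxplus> z"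
  using assms by (simp add: mv_le_def ominus_eq plus_assoc)

lemma ominus_le: "x \<in> carr A \<Longrightarrow> y \<in> carr A \<Longrightarrow> x \<boxminus> y \<sqsubseteq> x"
  by (simp add: ominus_le_iff le_plus')

text \<open>Contraposition up to a summand \<open>z\<close>; with \<open>z\<close> in an ideal this
  is what makes the congruence compatible with \<open>star\<close>.\<close>

lemma le_star_plus_iff:
  assumes "x \<in> carr A" "y \<in> carr A" "z \<in> carr A"
  shows "\<sim> y \<sqsubseteq> \<sim> x \<boxplus> z \<longleftrightarrow> x \<sqsubseteq> y \<boxplus> z"
  using assms by (simp add: mv_le_def plus_left_commute)

text \<open>Both sides are the meet of \<open>x\<close> and \<open>y\<close>; the identity is the
  dual of \<open>lukasiewicz\<close>, obtained by applying it to the complements.\<close>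

lemma ominus_ominus_commute:
  assumes "x \<in> carr A" "y \<in> carr A"
  shows "y \<boxminus> (y \<boxminus> x) = x \<boxminus> (x \<boxminus> y)"
proof -
  have "\<sim> y \<boxplus> \<sim> (\<sim> y \<boxplus> x) = \<sim> x \<boxplus> \<sim> (\<sim> x \<boxplus> y)"
    using assms lukasiewicz[of "\<sim> x" "\<sim> y"] by (simp add: plus_commute)
  then show ?thesis
    using assms by (simp add: ominus_eq)
qed

text \<open>The meet of \<open>x\<close> and \<open>y\<close> plus the excess of \<open>x\<close>
  over \<open>y\<close> gives \<open>x\<close>. Read from \<open>y\<close>, this reaches
  \<open>x\<close> by first subtracting \<open>y \<boxminus> x\<close> and then adding
  \<open>x \<boxminus> y\<close>.\<close>

lemma ominus_plus_decomposition:
  assumes "x \<in> carr A" "y \<in> carr A"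
  shows "y \<boxminus> (y \<boxminus> x) \<boxplus> (x \<boxminus> y) = x"
proof -
  have "x \<boxminus> (x \<boxminus> y) \<boxplus> (x \<boxminus> y) = x"
    using assms ominus_le[of x y] le_imp_plus_ominus[of "x \<boxminus> y" x] by (simp add: plus_commute)
  then show ?thesis
    using assms by (simp add: ominus_ominus_commute)
qed

end

section \<open>Ideals and the congruences they induce\<close>

locale mv_ideal_algebra = mv_algebra +
  fixes I :: "'a set"
  assumes ideal: "mv_ideal A I"
begin

lemma ideal_carr: "x \<in> I \<Longrightarrow> x \<in> carr A"
  and ideal_zero [simp]: "\<zero> \<in> I"
  and ideal_plus: "x \<in> I \<Longrightarrow> y \<in> I \<Longrightarrow> x \<boxplus> y \<in> I"
  and ideal_le: "x \<in> I \<Longrightarrow> y \<in> carr A \<Longrightarrow> y \<sqsubseteq> x \<Longrightarrow> y \<in> I"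
  using ideal unfolding mv_ideal_def by auto

text \<open>By residuation, with \<open>x \<boxminus> y\<close> itself as the least possible slack.
  Inequalities with slack in \<open>I\<close> can be chained and added, which is how transitivity
  and compatibility with \<open>plus\<close> are shown below.\<close>

lemma ominus_in_ideal_iff:
  assumes "x \<in> carr A" "y \<in> carr A"
  shows "x \<boxminus> y \<in> I \<longleftrightarrow> (\<exists>a\<in>I. x \<sqsubseteq> y \<boxplus> a)"
proof
  assume "x \<boxminus> y \<in> I"
  then show "\<exists>a\<in>I. x \<sqsubseteq> y \<boxplus> a"
    using assms ominus_le_iff[of x y "x \<boxminus> y"] le_refl by auto
next
  assume "\<exists>a\<in>I. x \<sqsubseteq> y \<boxplus> a"
  then show "x \<boxminus> y \<in> I"
    using assms ominus_le_iff ideal_le[OF _ ominus_carr] ideal_carr by auto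
qed

lemma plus_in_ideal_iff:
  assumes "x \<in> carr A" "y \<in> carr A"
  shows "x \<boxplus> y \<in> I \<longleftrightarrow> x \<in> I \<and> y \<in> I"
  using ideal_plus ideal_le[OF _ assms(1) le_plus[OF assms]] ideal_le[OF _ assms(2) le_plus'[OF assms(2,1)]]
  by blast

lemma cong_iff_ominus:
  "(x, y) \<in> mv_cong A I \<longleftrightarrow> x \<in> carr A \<and> y \<in> carr A \<and> x \<boxminus> y \<in> I \<and> y \<boxminus> x \<in> I"
  unfolding mv_cong_def by (auto simp: plus_in_ideal_iff)

lemma cong_iff:
  "(x, y) \<in> mv_cong A I \<longleftrightarrow>
     x \<in> carr A \<and> y \<in> carr A \<and> (\<exists>a\<in>I. x \<sqsubseteq> y \<boxplus> a) \<and> (\<exists>a\<in>I. y \<sqsubseteq> x \<boxplus> a)"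
  using cong_iff_ominus ominus_in_ideal_iff by blast

lemma cong_refl: "x \<in> carr A \<Longrightarrow> (x, x) \<in> mv_cong A I"
  by (simp add: cong_iff_ominus ominus_eq)

lemma cong_sym: "(x, y) \<in> mv_cong A I \<Longrightarrow> (y, x) \<in> mv_cong A I"
  by (auto simp: cong_iff)

lemma le_ideal_trans:
  assumes "x \<in> carr A" "y \<in> carr A" "z \<in> carr A"
    and "\<exists>a\<in>I. x \<sqsubseteq> y \<boxplus> a" "\<exists>a\<in>I. y \<sqsubseteq> z \<boxplus> a"
  shows "\<exists>a\<in>I. x \<sqsubseteq> z \<boxplus> a"
proof -
  obtain a b where ab: "a \<in> I" "b \<in> I" "x \<sqsubseteq> y \<boxplus> a" "y \<sqsubseteq> z \<boxplus> b"
    using assms by blast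
  then have "y \<boxplus> a \<sqsubseteq> z \<boxplus> b \<boxplus> a"
    using assms ideal_carr by (intro plus_mono_left) auto
  then have "x \<sqsubseteq> z \<boxplus> b \<boxplus> a"
    using ab assms ideal_carr le_trans[of x "y \<boxplus> a" "z \<boxplus> b \<boxplus> a"] by simp
  then show ?thesis
    using ab assms ideal_carr ideal_plus[of b a] by (auto simp: plus_assoc)
qed

lemma cong_trans:
  "(x, y) \<in> mv_cong A I \<Longrightarrow> (y, z) \<in> mv_cong A I \<Longrightarrow> (x, z) \<in> mv_cong A I"
  unfolding cong_iff using le_ideal_trans[of x y z] le_ideal_trans[of z y x] by blast

lemma equiv_cong: "equiv (carr A) (mv_cong A I)"
proof (rule equivI)
  show "mv_cong A I \<subseteq> carr A \<times> carr A"
    by (auto simp: mv_cong_def)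
qed (auto simp: refl_on_def sym_def trans_def intro: cong_refl cong_sym cong_trans)

lemma le_ideal_plus:
  assumes "x \<in> carr A" "x' \<in> carr A" "y \<in> carr A" "y' \<in> carr A"
    and "\<exists>a\<in>I. x \<sqsubseteq> x' \<boxplus> a" "\<exists>a\<in>I. y \<sqsubseteq> y' \<boxplus> a"
  shows "\<exists>a\<in>I. x \<boxplus> y \<sqsubseteq> x' \<boxplus> y' \<boxplus> a"
proof -
  obtain a b where ab: "a \<in> I" "b \<in> I" "x \<sqsubseteq> x' \<boxplus> a" "y \<sqsubseteq> y' \<boxplus> b"
    using assms by blast
  then have "x \<boxplus> y \<sqsubseteq> (x' \<boxplus> a) \<boxplus> (y' \<boxplus> b)"
    using assms ideal_carr by (intro plus_mono) auto
  also have "(x' \<boxplus> a) \<boxplus> (y' \<boxplus> b) = x' \<boxplus> y' \<boxplus> (a \<boxplus> b)"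
    using assms ab ideal_carr by (simp add: plus_ac)
  finally show ?thesis
    using ab ideal_plus by blast
qed

lemma cong_plus:
  "(x, x') \<in> mv_cong A I \<Longrightarrow> (y, y') \<in> mv_cong A I \<Longrightarrow> (x \<boxplus> y, x' \<boxplus> y') \<in> mv_cong A I"
  unfolding cong_iff using le_ideal_plus[of x x' y y'] le_ideal_plus[of x' x y' y] by simp

lemma cong_star: "(x, y) \<in> mv_cong A I \<Longrightarrow> (\<sim> x, \<sim> y) \<in> mv_cong A I"
  unfolding cong_iff using le_star_plus_iff[of x y] le_star_plus_iff[of y x] ideal_carr
  by auto

lemma cong_ominus:
  "(x, x') \<in> mv_cong A I \<Longrightarrow> (y, y') \<in> mv_cong A I \<Longrightarrow> (x \<boxminus> y, x' \<boxminus> y') \<in> mv_cong A I"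
  unfolding ominus_def odot_def by (intro cong_star cong_plus)

lemma ideal_cong_zero: "a \<in> I \<Longrightarrow> (a, \<zero>) \<in> mv_cong A I"
  using ideal_carr by (auto simp: cong_iff_ominus ominus_eq)

lemma cong_perturb:
  assumes "x \<in> carr A" "a \<in> I" "b \<in> I"
  shows "(x \<boxminus> b \<boxplus> a, x) \<in> mv_cong A I"
  using cong_plus[OF cong_ominus[OF cong_refl ideal_cong_zero] ideal_cong_zero, of x b a] assms
  by (simp add: ominus_eq)

text \<open>Describes a class as the image of a continuous expression in \<open>y\<close>,
  \<open>b\<close> and \<open>a\<close>, so that density of \<open>A\<close> in \<beta>A and of
  \<open>I\<close> in its closure can be brought to bear. From left to right the witnesses are
  \<open>a = x \<boxminus> y\<close> and \<open>b = y \<boxminus> x\<close>.\<close>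

lemma cong_iff_perturb:
  "(x, y) \<in> mv_cong A I \<longleftrightarrow> y \<in> carr A \<and> (\<exists>a\<in>I. \<exists>b\<in>I. x = y \<boxminus> b \<boxplus> a)"
proof
  assume "(x, y) \<in> mv_cong A I"
  then show "y \<in> carr A \<and> (\<exists>a\<in>I. \<exists>b\<in>I. x = y \<boxminus> b \<boxplus> a)"
    using cong_iff_ominus ominus_plus_decomposition by metis
next
  assume "y \<in> carr A \<and> (\<exists>a\<in>I. \<exists>b\<in>I. x = y \<boxminus> b \<boxplus> a)"
  then show "(x, y) \<in> mv_cong A I"
    using cong_perturb by blast
qed

lemma class_eq_iff:
  "x \<in> carr A \<Longrightarrow> y \<in> carr A \<Longrightarrow> mv_class A I x = mv_class A I y \<longleftrightarrow> (x, y) \<in> mv_cong A I"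
  unfolding mv_class_def using eq_equiv_class_iff[OF equiv_cong] by blast

lemma mem_class_iff: "y \<in> mv_class A I x \<longleftrightarrow> (x, y) \<in> mv_cong A I"
  by (simp add: mv_class_def)

end

section \<open>Quotients of topological MV-algebras\<close>

text \<open>The axioms are equations, so they pass to a surjective image; \<open>Y\<close> is not
  presupposed to satisfy any of them.\<close>

lemma MV_algebra_hom_image:
  assumes "MV_algebra X" and h: "mv_hom X Y h" and onto: "h ` carr X = carr Y"
  shows "MV_algebra Y"
proof -
  interpret mv_algebra X
    by unfold_locales fact
  have hom: "zero Y = h (zero X)" "\<And>x. x \<in> carr X \<Longrightarrow> star Y (h x) = h (star X x)"
    "\<And>x y. x \<in> carr X \<Longrightarrow> y \<in> carr X \<Longrightarrow> plus Y (h x) (h y) = h (plus X x y)"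
    using h by (auto simp: mv_hom_def)
  \<comment> \<open>The axiom is written with \<open>star X (zero X)\<close>, which the simp rule
    \<open>star_zero\<close> would fold into \<open>one X\<close>; hence this restatement and the
    deletions of that rule.\<close>
  have plus_star_zero: "plus X x (star X (zero X)) = star X (zero X)" if "x \<in> carr X" for x
    using plus_one[OF that] by (simp add: one_def del: star_zero)
  show ?thesis
    unfolding MV_algebra_def onto[symmetric] ball_simps
    by (simp add: hom plus_assoc plus_star_zero lukasiewicz del: star_zero)
      (use plus_commute in metis)
qed

section \<open>Continuity, closures and open maps on products\<close>

lemma continuous_map_plus:
  assumes "continuous_map (prod_topology T T) T (\<lambda>(x, y). plus A x y)"
    and "continuous_map X T f" "continuous_map X T g"
  shows "continuous_map X T (\<lambda>x. plus A (f x) (g x))"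
proof -
  have "continuous_map X (prod_topology T T) (\<lambda>x. (f x, g x))"
    using assms(2,3) by (simp add: continuous_map_pairedI)
  from continuous_map_compose[OF this assms(1)] show ?thesis
    by (simp add: o_def)
qed

lemma continuous_map_star:
  assumes "continuous_map T T (star A)" "continuous_map X T f"
  shows "continuous_map X T (\<lambda>x. star A (f x))"
  using continuous_map_compose[OF assms(2,1)] by (simp add: o_def)

text \<open>The MV axioms and the perturbation expression have at most three variables, so this
  product serves as the common domain of the density arguments about them.\<close>

lemma continuous_map_triple:
  shows "continuous_map (prod_topology X (prod_topology Y Z)) X fst"
    and "continuous_map (prod_topology X (prod_topology Y Z)) Y (\<lambda>p. fst (snd p))"
    and "continuous_map (prod_topology X (prod_topology Y Z)) Z (\<lambda>p. snd (snd p))"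
  using continuous_map_compose[OF continuous_map_snd continuous_map_fst, of X Y Z]
    continuous_map_compose[OF continuous_map_snd continuous_map_snd, of X Y Z]
  by (simp_all add: o_def continuous_map_fst)

lemma closure_of_triple:
  "x \<in> X closure_of S \<Longrightarrow> y \<in> Y closure_of T \<Longrightarrow> z \<in> Z closure_of U \<Longrightarrow>
    (x, y, z) \<in> prod_topology X (prod_topology Y Z) closure_of (S \<times> T \<times> U)"
  by (simp add: closure_of_Times)

text \<open>A product of quotient maps need not be a quotient map, whereas openness does survive
  products: a box inside \<open>W\<close> is sent to a box.\<close>

lemma open_map_prod:
  assumes "open_map X X' f" "open_map Y Y' g"
  shows "open_map (prod_topology X Y) (prod_topology X' Y') (\<lambda>(x, y). (f x, g y))"
  unfolding open_map_def
proof (intro allI impI)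
  fix W assume W: "openin (prod_topology X Y) W"
  show "openin (prod_topology X' Y') ((\<lambda>(x, y). (f x, g y)) ` W)"
    unfolding openin_prod_topology_alt
  proof (intro allI impI)
    fix u v assume "(u, v) \<in> (\<lambda>(x, y). (f x, g y)) ` W"
    then obtain x y where xy: "(x, y) \<in> W" "u = f x" "v = g y"
      by auto
    then obtain U V where UV: "openin X U" "openin Y V" "x \<in> U" "y \<in> V" "U \<times> V \<subseteq> W"
      using W unfolding openin_prod_topology_alt by meson
    have "f ` U \<times> g ` V \<subseteq> (\<lambda>(x, y). (f x, g y)) ` W"
      using UV(5) by force
    then show "\<exists>U V. openin X' U \<and> openin Y' V \<and> u \<in> U \<and> v \<in> V \<and>
        U \<times> V \<subseteq> (\<lambda>(x, y). (f x, g y)) ` W"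
      using assms UV xy unfolding open_map_def by blast
  qed
qed

locale top_mv_algebra = mv_algebra A for A :: "'a top_mv" +
  assumes topspace_eq: "topspace (top_of A) = carr A"
    and cont_plus: "continuous_map (prod_topology (top_of A) (top_of A)) (top_of A) (\<lambda>(x, y). plus A x y)"
    and cont_star: "continuous_map (top_of A) (top_of A) (star A)"
begin

lemmas continuous_plus = continuous_map_plus[OF cont_plus]
lemmas continuous_star = continuous_map_star[OF cont_star]

lemma continuous_ominus:
  assumes "continuous_map X (top_of A) f" "continuous_map X (top_of A) g"
  shows "continuous_map X (top_of A) (\<lambda>x. f x \<boxminus> g x)"
  unfolding ominus_def odot_def by (intro continuous_plus continuous_star assms)

end

section \<open>The quotient as a topological MV-algebra\<close>

locale top_mv_ideal = top_mv_algebra A + mv_ideal_algebra A I for A :: "'a top_mv" and I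
begin

abbreviation Q :: "'a set top_mv" where "Q \<equiv> mv_quotient A I"
abbreviation q :: "'a \<Rightarrow> 'a set" where "q \<equiv> mv_class A I"

lemma carr_quotient: "carr Q = q ` carr A"
  by (auto simp: mv_quotient_def mv_class_def quotient_def)

lemma top_of_quotient: "top_of Q = quotient_topology (top_of A) q"
  by (simp add: mv_quotient_def)

lemma zero_quotient: "zero Q = q \<zero>"
  by (simp add: mv_quotient_def)

text \<open>All members of the defining union coincide by \<open>cong_plus\<close>, and reflexivity
  makes the union nonempty.\<close>

lemma plus_quotient:
  assumes "x \<in> carr A" "y \<in> carr A"
  shows "plus Q (q x) (q y) = q (x \<boxplus> y)"
proof -
  have "q (u \<boxplus> v) = q (x \<boxplus> y)" if "u \<in> q x" "v \<in> q y" for u v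
  proof -
    have "(x, u) \<in> mv_cong A I" "(y, v) \<in> mv_cong A I"
      using that by (simp_all add: mem_class_iff)
    then show ?thesis
      using cong_plus[of x u y v] class_eq_iff[of "x \<boxplus> y" "u \<boxplus> v"] by (simp add: cong_iff)
  qed
  moreover have "x \<in> q x" "y \<in> q y"
    using assms by (simp_all add: mem_class_iff cong_refl)
  ultimately have "(\<Union>u\<in>q x. \<Union>v\<in>q y. q (u \<boxplus> v)) = q (x \<boxplus> y)"
    by blast
  then show ?thesis
    by (simp add: mv_quotient_def)
qed

lemma star_quotient:
  assumes "x \<in> carr A"
  shows "star Q (q x) = q (\<sim> x)"
proof -
  have "q (\<sim> u) = q (\<sim> x)" if "u \<in> q x" for u
  proof -
    have "(x, u) \<in> mv_cong A I"
      using that by (simp add: mem_class_iff)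
    then show ?thesis
      using cong_star[of x u] class_eq_iff[of "\<sim> x" "\<sim> u"] by (simp add: cong_iff)
  qed
  moreover have "x \<in> q x"
    using assms by (simp add: mem_class_iff cong_refl)
  ultimately have "(\<Union>u\<in>q x. q (\<sim> u)) = q (\<sim> x)"
    by blast
  then show ?thesis
    by (simp add: mv_quotient_def)
qed

lemma hom_class: "mv_hom A Q q"
  unfolding mv_hom_def
  by (simp add: carr_quotient zero_quotient plus_quotient star_quotient)

lemma MV_quotient: "MV_algebra Q"
  using MV_algebra_hom_image[OF MV hom_class] by (simp add: carr_quotient)

lemma topspace_quotient: "topspace (top_of Q) = carr Q"
  by (simp add: top_of_quotient topspace_quotient_topology carr_quotient topspace_eq)

lemma quotient_map_class: "quotient_map (top_of A) (top_of Q) q"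
  unfolding top_of_quotient by (rule quotient_map_quotient_topology)

lemma continuous_map_class: "continuous_map (top_of A) (top_of Q) q"
  by (rule quotient_imp_continuous_map[OF quotient_map_class])

text \<open>A translation \<open>y \<mapsto> (y \<ominus> b) \<oplus> a\<close> with \<open>a, b \<in> I\<close> stays within each class and can move
  any point to any congruent one, so the saturation of an open set is a union of preimages of it.\<close>

lemma open_map_class: "open_map (top_of A) (top_of Q) q"
  unfolding open_map_def top_of_quotient openin_quotient_topology
proof (intro allI impI conjI)
  fix U assume U: "openin (top_of A) U"
  then have UA: "U \<subseteq> carr A"
    using openin_subset topspace_eq by blast
  then show "q ` U \<subseteq> q ` topspace (top_of A)"
    using topspace_eq by blast
  show "openin (top_of A) {x \<in> topspace (top_of A). q x \<in> q ` U}"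
  proof (subst openin_subopen, intro ballI)
    fix x assume "x \<in> {x \<in> topspace (top_of A). q x \<in> q ` U}"
    then obtain u where x: "x \<in> carr A" "u \<in> U" "q u = q x"
      using topspace_eq by auto
    then obtain a b where ab: "a \<in> I" "b \<in> I" "u = x \<boxminus> b \<boxplus> a"
      using class_eq_iff cong_iff_perturb UA by blast
    let ?T = "{y \<in> topspace (top_of A). y \<boxminus> b \<boxplus> a \<in> U}"
    have "continuous_map (top_of A) (top_of A) (\<lambda>y. y \<boxminus> b \<boxplus> a)"
      by (intro continuous_plus continuous_ominus) (use ab ideal_carr topspace_eq in auto)
    then have "openin (top_of A) ?T"
      using U by (rule openin_continuous_map_preimage)
    moreover have "?T \<subseteq> {x \<in> topspace (top_of A). q x \<in> q ` U}"
    proof clarify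
      fix y assume y: "y \<in> topspace (top_of A)" "y \<boxminus> b \<boxplus> a \<in> U"
      then have "q y = q (y \<boxminus> b \<boxplus> a)"
        using cong_perturb[of y a b] ab topspace_eq UA class_eq_iff[of "y \<boxminus> b \<boxplus> a" y] by auto
      then show "q y \<in> q ` U"
        using y by blast
    qed
    ultimately show "\<exists>T. openin (top_of A) T \<and> x \<in> T \<and> T \<subseteq> {x \<in> topspace (top_of A). q x \<in> q ` U}"
      using x ab topspace_eq by (intro exI[of _ ?T]) auto
  qed
qed

text \<open>Since \<open>q\<close> is open, its square is an open continuous surjection and hence a
  quotient map. Continuity of addition on classes can therefore be tested on pairs of
  representatives.\<close>

lemma top_mv_quotient: "top_mv_algebra Q"
proof unfold_locales
  show "MV_algebra Q" "topspace (top_of Q) = carr Q"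
    by (rule MV_quotient topspace_quotient)+
  let ?TT = "prod_topology (top_of A) (top_of A)" and ?qq = "\<lambda>(x, y). (q x, q y)"
  have "continuous_map ?TT (prod_topology (top_of Q) (top_of Q)) ?qq"
    using continuous_map_compose[OF continuous_map_fst continuous_map_class, of "top_of A"]
      continuous_map_compose[OF continuous_map_snd continuous_map_class, of "top_of A"]
    by (simp add: case_prod_unfold continuous_map_pairedI o_def)
  then have quo: "quotient_map ?TT (prod_topology (top_of Q) (top_of Q)) ?qq"
    using open_map_prod[OF open_map_class open_map_class]
    by (rule continuous_open_imp_quotient_map)
       (auto simp: topspace_quotient carr_quotient topspace_eq)
  have "continuous_map ?TT (top_of Q) (q \<circ> (\<lambda>(x, y). x \<boxplus> y))"
    using cont_plus continuous_map_class by (rule continuous_map_compose)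
  then have "continuous_map ?TT (top_of Q) ((\<lambda>(P, R). plus Q P R) \<circ> ?qq)"
    by (rule continuous_map_eq) (auto simp: topspace_eq plus_quotient)
  then show "continuous_map (prod_topology (top_of Q) (top_of Q)) (top_of Q) (\<lambda>(P, R). plus Q P R)"
    by (rule continuous_compose_quotient_map[OF quo])
  have "continuous_map (top_of A) (top_of Q) (q \<circ> star A)"
    using cont_star continuous_map_class by (rule continuous_map_compose)
  then have "continuous_map (top_of A) (top_of Q) (star Q \<circ> q)"
    by (rule continuous_map_eq) (auto simp: topspace_eq star_quotient)
  then show "continuous_map (top_of Q) (top_of Q) (star Q)"
    by (rule continuous_compose_quotient_map[OF quotient_map_class])
qed

text \<open>The congruence is closed, being the preimage of \<open>I\<close> under a continuous map.
  A noncongruent pair thus has a box neighbourhood of noncongruent pairs, whose sides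
  \<open>q\<close> sends to disjoint open sets.\<close>

lemma Hausdorff_quotient:
  assumes "closedin (top_of A) I"
  shows "Hausdorff_space (top_of Q)"
  unfolding Hausdorff_space_def
proof (intro allI impI)
  fix P R assume "P \<in> topspace (top_of Q) \<and> R \<in> topspace (top_of Q) \<and> P \<noteq> R"
  then obtain x y where xy: "x \<in> carr A" "y \<in> carr A" "P = q x" "R = q y" "q x \<noteq> q y"
    by (auto simp: topspace_quotient carr_quotient)
  let ?TT = "prod_topology (top_of A) (top_of A)"
  \<comment> \<open>The distance function of the MV-algebra, evaluated on a pair.\<close>
  let ?d = "\<lambda>p. (fst p \<boxminus> snd p) \<boxplus> (snd p \<boxminus> fst p)"
  let ?W = "{p \<in> topspace ?TT. ?d p \<in> topspace (top_of A) - I}"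
  have "continuous_map ?TT (top_of A) ?d"
    by (intro continuous_plus continuous_ominus continuous_map_fst continuous_map_snd)
  then have W: "openin ?TT ?W"
    using assms by (intro openin_continuous_map_preimage) auto
  have cong: "(u, v) \<in> mv_cong A I \<longleftrightarrow> ?d (u, v) \<in> I" if "u \<in> carr A" "v \<in> carr A" for u v
    using that by (simp add: mv_cong_def)
  have "(x, y) \<in> ?W"
    using xy cong class_eq_iff topspace_eq by auto
  then obtain U V where UV: "openin (top_of A) U" "openin (top_of A) V" "x \<in> U" "y \<in> V"
      "U \<times> V \<subseteq> ?W"
    using W unfolding openin_prod_topology_alt by meson
  have "disjnt (q ` U) (q ` V)"
  proof -
    have "q u \<noteq> q v" if "u \<in> U" "v \<in> V" for u v
      using UV(5) that cong class_eq_iff topspace_eq by (auto simp: subset_iff)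
    then show ?thesis
      unfolding disjnt_def by auto
  qed
  then show "\<exists>U V. openin (top_of Q) U \<and> openin (top_of Q) V \<and> P \<in> U \<and> R \<in> V \<and> disjnt U V"
    using UV xy open_map_class unfolding open_map_def by blast
qed

end

section \<open>Stone-Cech compactifications\<close>

lemma forall_in_closure_of_map:
  assumes "p \<in> X closure_of S" "continuous_map X W f" "closedin W K" "\<And>p. p \<in> S \<Longrightarrow> f p \<in> K"
  shows "f p \<in> K"
  using assms(1,4) closedin_continuous_map_preimage[OF assms(2,3)] by (rule forall_in_closure_of)

lemma compact_Hausdorff_imp_Tychonoff:
  "compact_space X \<Longrightarrow> Hausdorff_space X \<Longrightarrow> Tychonoff_space X"
  by (simp add: Tychonoff_space_def compact_Hausdorff_or_regular_imp_normal_space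
      normal_imp_completely_regular_space)

text \<open>Identifies the coordinates of \<open>sc_cube\<close> with the index set in
  \<open>completely_regular_space_cube_embedding_explicit\<close>; boundedness is automatic for
  values in the unit interval.\<close>

lemma unit_functions_eq_mspace:
  "unit_functions X = mspace (submetric (cfunspace X euclidean_metric) {f. f \<in> topspace X \<rightarrow> {0..1}})"
proof -
  have "bounded (f ` topspace X)" if "f \<in> topspace X \<rightarrow> {0..1}" for f :: "'a \<Rightarrow> real"
    using that by (metis bounded_closed_interval bounded_subset image_subset_iff_funcset)
  then show ?thesis
    by (auto simp: unit_functions_def continuous_map_in_subtopology image_subset_iff_funcset)
qed

lemma embedding_map_sc_emb:
  "Tychonoff_space X \<Longrightarrow> embedding_map X (sc_cube X) (sc_emb X)"
  using completely_regular_space_cube_embedding_explicit[of X]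
  unfolding Tychonoff_space_def unit_functions_eq_mspace[symmetric] sc_cube_def[symmetric]
    sc_emb_def[symmetric] by blast

lemma continuous_map_sc_emb: "continuous_map X (sc_cube X) (sc_emb X)"
proof -
  have "continuous_map X (top_of_set {0..1}) (\<lambda>x. sc_emb X x f)" if "f \<in> unit_functions X" for f
    using that by (simp add: sc_emb_def unit_functions_def)
  then show ?thesis
    unfolding sc_cube_def by (auto simp: continuous_map_componentwise sc_emb_def)
qed

lemma sc_emb_subset: "sc_emb X ` topspace X \<subseteq> topspace (stone_cech X)"
proof -
  have "sc_emb X ` topspace X \<subseteq> topspace (sc_cube X)"
    using continuous_map_sc_emb by (rule continuous_map_image_subset_topspace)
  then show ?thesis
    unfolding stone_cech_def by (simp add: closure_of_subset)
qed

lemma embedding_map_stone_cech: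
  "Tychonoff_space X \<Longrightarrow> embedding_map X (stone_cech X) (sc_emb X)"
  using embedding_map_sc_emb sc_emb_subset[of X]
  by (simp add: stone_cech_def embedding_map_in_subtopology)

lemma topspace_stone_cech: "topspace (stone_cech X) = sc_cube X closure_of (sc_emb X ` topspace X)"
  by (simp add: stone_cech_def closure_of_subset_topspace Int_absorb1)

lemma dense_stone_cech: "stone_cech X closure_of (sc_emb X ` topspace X) = topspace (stone_cech X)"
  using sc_emb_subset[of X]
  by (simp add: stone_cech_def closure_of_subtopology Int_absorb1 closure_of_subset_topspace)

lemma Hausdorff_sc_cube: "Hausdorff_space (sc_cube X)"
  by (simp add: sc_cube_def Hausdorff_space_product_topology Hausdorff_space_subtopology)

lemma Hausdorff_stone_cech: "Hausdorff_space (stone_cech X)"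
  by (simp add: stone_cech_def Hausdorff_sc_cube Hausdorff_space_subtopology)

lemma compact_stone_cech: "compact_space (stone_cech X)"
proof -
  have "compact_space (sc_cube X)"
    by (simp add: sc_cube_def compact_space_product_topology compact_space_subtopology)
  then show ?thesis
    unfolding stone_cech_def by (intro compact_space_subtopology closedin_compact_space) auto
qed

text \<open>The two sides of each axiom are continuous maps into a Hausdorff space that agree on the
  dense image of \<open>A\<close>, hence everywhere.\<close>

lemma stone_cech_MV:
  assumes "MV_algebra A" "topspace (top_of A) = carr A" and sc: "is_stone_cech_MV A B"
  shows "MV_algebra B"
proof -
  interpret A: mv_algebra A
    by unfold_locales fact
  define e where "e = sc_emb (top_of A)"
  define T where "T = top_of B"
  have plus: "continuous_map (prod_topology T T) T (\<lambda>(x, y). plus B x y)"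
    and star: "continuous_map T T (star B)" and hom: "mv_hom A B e"
    and T: "T = stone_cech (top_of A)" and carr: "carr B = topspace T"
    using sc by (auto simp: is_stone_cech_MV_def T_def e_def)
  let ?T = "prod_topology T (prod_topology T T)"
  note cont = continuous_map_plus[OF plus] continuous_map_star[OF star] continuous_map_triple[of T T T]
  have e: "e x \<in> carr B" if "x \<in> carr A" for x
    using hom that by (auto simp: mv_hom_def)
  have hom_zero: "zero B = e (zero A)" and hom_star: "\<And>x. x \<in> carr A \<Longrightarrow> star B (e x) = e (star A x)"
    and hom_plus: "\<And>x y. x \<in> carr A \<Longrightarrow> y \<in> carr A \<Longrightarrow> plus B (e x) (e y) = e (plus A x y)"
    using hom by (auto simp: mv_hom_def)
  have closure: "T closure_of (e ` carr A) = carr B"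
    using dense_stone_cech[of "top_of A"] assms(2) by (simp add: T carr e_def)
  \<comment> \<open>For axioms in fewer than three variables, the spare coordinates are filled below
    by repeating an argument.\<close>
  have id3: "f (x, y, z) = g (x, y, z)"
    if "continuous_map ?T T f" "continuous_map ?T T g" "x \<in> carr B" "y \<in> carr B" "z \<in> carr B"
      "\<And>a b c. a \<in> carr A \<Longrightarrow> b \<in> carr A \<Longrightarrow> c \<in> carr A \<Longrightarrow> f (e a, e b, e c) = g (e a, e b, e c)"
    for f g x y z
  proof (rule forall_in_closure_of_eq[OF _ _ that(1,2)])
    show "(x, y, z) \<in> ?T closure_of (e ` carr A \<times> e ` carr A \<times> e ` carr A)"
      using that(3-5) by (simp add: closure_of_triple closure)
    show "Hausdorff_space T"
      by (simp add: T Hausdorff_stone_cech)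
  qed (use that(6) in auto)
  have star_zero: "star A (zero A) \<in> carr A"
    by (intro A.star_carr A.zero_carr)
  have plus_star_zero: "plus A x (star A (zero A)) = star A (zero A)" if "x \<in> carr A" for x
    using A.plus_one[OF that] by (simp add: one_def del: A.star_zero)
  note hom = hom_zero hom_star hom_plus A.plus_carr A.star_carr A.zero_carr
  show ?thesis
    unfolding MV_algebra_def
  proof (intro conjI ballI)
    show "zero B \<in> carr B"
      using hom_zero e by simp
    show "star B x \<in> carr B" if "x \<in> carr B" for x
      using continuous_map_image_subset_topspace[OF star] that by (auto simp: carr)
    show "plus B x y \<in> carr B" if "x \<in> carr B" "y \<in> carr B" for x y
      using continuous_map_image_subset_topspace[OF plus] that by (auto simp: carr)
    show "plus B (plus B x y) z = plus B x (plus B y z)"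
      if "x \<in> carr B" "y \<in> carr B" "z \<in> carr B" for x y z
      using id3[of "\<lambda>p. plus B (plus B (fst p) (fst (snd p))) (snd (snd p))"
          "\<lambda>p. plus B (fst p) (plus B (fst (snd p)) (snd (snd p)))", OF _ _ that]
      by (simp add: cont hom A.plus_assoc)
    show "plus B x y = plus B y x" if "x \<in> carr B" "y \<in> carr B" for x y
      using id3[of "\<lambda>p. plus B (fst p) (fst (snd p))"
          "\<lambda>p. plus B (fst (snd p)) (fst p)", OF _ _ that that(1)]
      by (simp add: cont hom A.plus_commute)
    show "plus B x (zero B) = x" if "x \<in> carr B" for x
      using id3[of "\<lambda>p. plus B (fst p) (zero B)" fst, OF _ _ that that that]
      by (simp add: cont e carr[symmetric] hom A.plus_zero)
    show "star B (star B x) = x" if "x \<in> carr B" for x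
      using id3[of "\<lambda>p. star B (star B (fst p))" fst, OF _ _ that that that]
      by (simp add: cont hom A.star_star)
    show "plus B x (star B (zero B)) = star B (zero B)" if "x \<in> carr B" for x
      using id3[of "\<lambda>p. plus B (fst p) (star B (zero B))" "\<lambda>p. star B (zero B)", OF _ _ that that that]
      by (simp add: cont e carr[symmetric] hom plus_star_zero star_zero del: A.star_zero)
    show "plus B (star B (plus B (star B x) y)) y = plus B (star B (plus B (star B y) x)) x"
      if "x \<in> carr B" "y \<in> carr B" for x y
      using id3[of "\<lambda>p. plus B (star B (plus B (star B (fst p)) (fst (snd p)))) (fst (snd p))"
          "\<lambda>p. plus B (star B (plus B (star B (fst (snd p))) (fst p))) (fst p)", OF _ _ that that(1)]
      by (simp add: cont hom A.lukasiewicz)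
  qed
qed

section \<open>The closure of an ideal in the compactification\<close>

lemma topological_MV_imp_top_mv_algebra: "topological_MV A \<Longrightarrow> top_mv_algebra A"
  by (simp add: topological_MV_def top_mv_algebra_def top_mv_algebra_axioms_def mv_algebra_def)

lemma (in top_mv_algebra) topological_MV: "Tychonoff_space (top_of A) \<Longrightarrow> topological_MV A"
  by (simp add: topological_MV_def MV topspace_eq cont_plus cont_star)

locale stone_cech_ideal = top_mv_ideal A I for A :: "'a top_mv" and I +
  fixes B :: "(('a \<Rightarrow> real) \<Rightarrow> real) top_mv"
  assumes Tychonoff: "Tychonoff_space (top_of A)"
    and closed_ideal: "closedin (top_of A) I"
    and sc: "is_stone_cech_MV A B"
begin

abbreviation e :: "'a \<Rightarrow> ('a \<Rightarrow> real) \<Rightarrow> real" where "e \<equiv> sc_emb (top_of A)"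
definition J :: "(('a \<Rightarrow> real) \<Rightarrow> real) set" where "J = top_of B closure_of (e ` I)"

lemma top_B: "top_of B = stone_cech (top_of A)"
  and carr_B: "topspace (top_of B) = carr B"
  using sc by (simp_all add: is_stone_cech_MV_def)

sublocale B: top_mv_algebra B
  using stone_cech_MV[OF MV topspace_eq sc] sc carr_B
  unfolding is_stone_cech_MV_def top_mv_algebra_def top_mv_algebra_axioms_def mv_algebra_def
  by blast

lemma hom_e: "mv_hom A B e"
  using sc by (simp add: is_stone_cech_MV_def)

lemma e_carr [simp]: "x \<in> carr A \<Longrightarrow> e x \<in> carr B"
  and e_zero: "e (zero A) = zero B"
  and e_star: "x \<in> carr A \<Longrightarrow> e (star A x) = star B (e x)"
  and e_plus: "x \<in> carr A \<Longrightarrow> y \<in> carr A \<Longrightarrow> e (plus A x y) = plus B (e x) (e y)"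
  using hom_e by (auto simp: mv_hom_def)

lemma e_ominus: "x \<in> carr A \<Longrightarrow> y \<in> carr A \<Longrightarrow> e (ominus A x y) = ominus B (e x) (e y)"
  by (simp add: ominus_eq B.ominus_eq e_star e_plus)

lemma compact_B: "compact_space (top_of B)"
  by (simp add: top_B compact_stone_cech)

lemma dense_B: "top_of B closure_of (e ` carr A) = carr B"
  using dense_stone_cech[of "top_of A"] by (simp add: top_B topspace_eq carr_B[symmetric])

lemma homeomorphic_map_e: "homeomorphic_map (top_of A) (subtopology (top_of B) (e ` carr A)) e"
  using embedding_map_stone_cech[OF Tychonoff] by (simp add: embedding_map_def topspace_eq top_B)

lemma continuous_map_e: "continuous_map (top_of A) (top_of B) e"
  using homeomorphic_imp_continuous_map[OF homeomorphic_map_e]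
  by (simp add: continuous_map_in_subtopology)

lemma inj_e: "inj_on e (carr A)"
  using homeomorphic_imp_injective_map[OF homeomorphic_map_e] by (simp add: topspace_eq)

lemma open_in_B:
  assumes "openin (top_of A) U"
  obtains V where "openin (top_of B) V" "e ` U = V \<inter> e ` carr A"
proof -
  have "openin (subtopology (top_of B) (e ` carr A)) (e ` U)"
    using homeomorphic_imp_open_map[OF homeomorphic_map_e] assms by (simp add: open_map_def)
  then show thesis
    using that unfolding openin_subtopology by metis
qed

lemma J_carr: "J \<subseteq> carr B"
  unfolding J_def carr_B[symmetric] by (rule closure_of_subset_topspace)

lemma closed_J: "closedin (top_of B) J"
  by (simp add: J_def)

lemma e_in_J_iff:
  assumes "x \<in> carr A"
  shows "e x \<in> J \<longleftrightarrow> x \<in> I"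
proof
  have I: "I \<subseteq> carr A"
    using ideal_carr by blast
  have "closedin (subtopology (top_of B) (e ` carr A)) (e ` I)"
    using homeomorphic_imp_closed_map[OF homeomorphic_map_e] closed_ideal
    unfolding closed_map_def by blast
  then have "subtopology (top_of B) (e ` carr A) closure_of (e ` I) = e ` I"
    by (simp add: closure_of_eq)
  moreover have "e ` carr A \<inter> e ` I = e ` I"
    using I by blast
  ultimately have "e ` carr A \<inter> J = e ` I"
    by (simp add: J_def closure_of_subtopology)
  then show "e x \<in> J \<Longrightarrow> x \<in> I"
    using assms inj_e I by (metis IntI image_eqI inj_on_image_mem_iff)
next
  have "e ` I \<subseteq> topspace (top_of B)"
    using ideal_carr e_carr carr_B by blast
  then show "x \<in> I \<Longrightarrow> e x \<in> J"
    unfolding J_def using closure_of_subset by blast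
qed

text \<open>Closure under addition follows by continuity. Downward closure is an implication and
  does not pass to limits directly; it is replaced by the statement that the meet of an element of
  the ideal with any element is in the ideal.\<close>

lemma ideal_J: "mv_ideal B J"
  unfolding mv_ideal_def
proof (intro conjI ballI impI)
  let ?T = "prod_topology (top_of B) (prod_topology (top_of B) (top_of B))"
  note cont = B.continuous_plus B.continuous_ominus
    continuous_map_triple[of "top_of B" "top_of B" "top_of B"]
  show "J \<subseteq> carr B"
    by (rule J_carr)
  show "zero B \<in> J"
    using e_in_J_iff[of "zero A"] by (simp add: e_zero)
  show "plus B x y \<in> J" if "x \<in> J" "y \<in> J" for x y
  proof -
    \<comment> \<open>The last coordinate is only padding.\<close>
    have "(x, y, y) \<in> ?T closure_of (e ` I \<times> e ` I \<times> e ` I)"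
      using that by (simp add: closure_of_triple J_def)
    moreover have "continuous_map ?T (top_of B) (\<lambda>p. plus B (fst p) (fst (snd p)))"
      by (intro cont)
    ultimately have "(\<lambda>p. plus B (fst p) (fst (snd p))) (x, y, y) \<in> J"
      using closed_J
      by (rule forall_in_closure_of_map)
         (auto simp: e_plus[symmetric] e_in_J_iff ideal_carr ideal_plus)
    then show ?thesis by simp
  qed
  show "y \<in> J" if "x \<in> J" "y \<in> carr B" "mv_le B y x" for x y
  proof -
    have x: "x \<in> carr B"
      using that J_carr by blast
    have "(x, y, y) \<in> ?T closure_of (e ` I \<times> e ` carr A \<times> e ` carr A)"
      using that unfolding J_def by (intro closure_of_triple) (simp_all add: dense_B)
    moreover have "continuous_map ?T (top_of B) (\<lambda>p. ominus B (fst p) (ominus B (fst p) (fst (snd p))))"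
      by (intro cont)
    ultimately have "(\<lambda>p. ominus B (fst p) (ominus B (fst p) (fst (snd p)))) (x, y, y) \<in> J"
      using closed_J
    proof (rule forall_in_closure_of_map)
      fix p assume "p \<in> e ` I \<times> e ` carr A \<times> e ` carr A"
      then obtain a c where ac: "a \<in> I" "c \<in> carr A" "fst p = e a" "fst (snd p) = e c"
        by auto
      then have "ominus A a (ominus A a c) \<in> I"
        using ideal_le[of a] ominus_le[of a "ominus A a c"] ideal_carr by simp
      then show "ominus B (fst p) (ominus B (fst p) (fst (snd p))) \<in> J"
        using ac ideal_carr by (simp add: e_ominus[symmetric] e_in_J_iff)
    qed
    then have "ominus B x (ominus B x y) \<in> J"
      by simp
    moreover have "ominus B y x = zero B"
      using that x by (simp add: B.ominus_eq mv_le_def)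
    \<comment> \<open>The left side is the meet of \<open>x\<close> and \<open>y\<close>, which is
      \<open>y\<close> because \<open>y\<close> lies below \<open>x\<close>.\<close>
    then have "ominus B x (ominus B x y) = y"
      using B.ominus_ominus_commute[of x y] that x by (simp add: B.ominus_eq B.plus_commute)
    ultimately show ?thesis
      by simp
  qed
qed

sublocale B: top_mv_ideal B J
  by unfold_locales (rule ideal_J)

section \<open>Topology of the two quotients\<close>

lemma compact_BQ: "compact_space (top_of B.Q)"
  using compact_B B.continuous_map_class
  by (metis B.quotient_map_class compact_space_def image_compactin quotient_imp_surjective_map)

lemma Hausdorff_BQ: "Hausdorff_space (top_of B.Q)"
  by (rule B.Hausdorff_quotient[OF closed_J])

lemma Tychonoff_BQ: "Tychonoff_space (top_of B.Q)"
  using compact_BQ Hausdorff_BQ by (rule compact_Hausdorff_imp_Tychonoff)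

text \<open>Makes the induced map from A/I to \<beta>A/J both well defined and injective.\<close>

lemma e_cong_iff:
  assumes "x \<in> carr A" "y \<in> carr A"
  shows "(e x, e y) \<in> mv_cong B J \<longleftrightarrow> (x, y) \<in> mv_cong A I"
  using assms by (simp add: cong_iff_ominus B.cong_iff_ominus e_ominus[symmetric] e_in_J_iff)

text \<open>A/I embeds into the compact Hausdorff space \<beta>A/J, and complete regularity and the
  Hausdorff property are hereditary. The substance is that the induced injection \<open>h\<close> is
  open onto its image.\<close>

lemma Tychonoff_quotient: "Tychonoff_space (top_of Q)"
proof -
  have "continuous_map (top_of A) (top_of B.Q) (B.q \<circ> e)"
    using continuous_map_e B.continuous_map_class by (rule continuous_map_compose)
  moreover have "(B.q \<circ> e) x = (B.q \<circ> e) y"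
    if "x \<in> topspace (top_of A)" "y \<in> topspace (top_of A)" "q x = q y" for x y
    using that by (simp add: topspace_eq class_eq_iff B.class_eq_iff e_cong_iff)
  ultimately obtain h where h: "continuous_map (top_of Q) (top_of B.Q) h"
      "\<And>x. x \<in> topspace (top_of A) \<Longrightarrow> h (q x) = (B.q \<circ> e) x"
    using quotient_map_lift_exists[OF quotient_map_class] by metis
  have hq: "h (q x) = B.q (e x)" if "x \<in> carr A" for x
    using h(2) that by (simp add: topspace_eq)
  let ?S = "subtopology (top_of B.Q) (h ` carr Q)"
  have inj: "inj_on h (carr Q)"
    by (auto simp: inj_on_def carr_quotient hq class_eq_iff B.class_eq_iff e_cong_iff)
  have "open_map (top_of Q) ?S h"
    unfolding open_map_def openin_subtopology
  proof (intro allI impI)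
    fix W assume W: "openin (top_of Q) W"
    define U where "U = {x \<in> carr A. q x \<in> W}"
    have "openin (top_of A) U"
      unfolding U_def topspace_eq[symmetric]
      using continuous_map_class W by (rule openin_continuous_map_preimage)
    then obtain V where V: "openin (top_of B) V" "e ` U = V \<inter> e ` carr A"
      by (rule open_in_B)
    \<comment> \<open>The inclusion from right to left is the hard one: a class meeting both
      \<open>V\<close> and \<open>e\<close> carr
      A\<open>must be shown to meet\<close>V\<open>in a point of\<close>e
      \<open>carr A\<close>.\<close>
    have "h ` W = B.q ` V \<inter> h ` carr Q"
    proof (intro equalityI subsetI)
      fix P assume "P \<in> h ` W"
      then obtain R where "R \<in> W" "P = h R"
        by blast
      moreover have "W \<subseteq> carr Q"
        using openin_subset[OF W] by (simp add: topspace_quotient)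
      ultimately obtain x where "x \<in> U" "P = h (q x)"
        by (auto simp: carr_quotient U_def)
      then show "P \<in> B.q ` V \<inter> h ` carr Q"
        using V(2) hq by (auto simp: U_def carr_quotient)
    next
      fix P assume "P \<in> B.q ` V \<inter> h ` carr Q"
      then obtain v y where v: "v \<in> V" "P = B.q v" and y: "y \<in> carr A" "P = h (q y)"
        by (auto simp: carr_quotient)
      have "v \<in> carr B"
        using openin_subset[OF V(1)] v by (auto simp: carr_B)
      then have "(v, e y) \<in> mv_cong B J"
        using v y by (simp add: hq B.class_eq_iff[symmetric])
      then obtain \<alpha> \<beta> where ab: "\<alpha> \<in> J" "\<beta> \<in> J" "v = plus B (ominus B (e y) \<beta>) \<alpha>"
        unfolding B.cong_iff_perturb by blast
      text \<open>The elements \<open>\<alpha>, \<beta>\<close> of \<open>J\<close> can be replaced by elements of \<open>I\<close> without leaving \<open>V\<close>.\<close>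
      let ?T = "prod_topology (top_of B) (top_of B)"
      let ?f = "\<lambda>p. plus B (ominus B (e y) (snd p)) (fst p)"
      have cont: "continuous_map ?T (top_of B) ?f"
        by (intro B.continuous_plus B.continuous_ominus continuous_map_fst continuous_map_snd)
           (simp add: carr_B y)
      have "(\<alpha>, \<beta>) \<in> ?T closure_of (e ` I \<times> e ` I)"
        using ab by (simp add: closure_of_Times J_def)
      moreover have "(\<alpha>, \<beta>) \<in> {p \<in> topspace ?T. ?f p \<in> V}"
        using ab v J_carr by (auto simp: carr_B)
      ultimately have "\<exists>p. p \<in> e ` I \<times> e ` I \<and> p \<in> {p \<in> topspace ?T. ?f p \<in> V}"
        using openin_continuous_map_preimage[OF cont V(1)] by (simp only: in_closure_of)
      then obtain a b where I: "a \<in> I" "b \<in> I" "plus B (ominus B (e y) (e b)) (e a) \<in> V"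
        by auto
      \<comment> \<open>This point of \<open>A\<close> is congruent to \<open>y\<close> and is
        mapped into \<open>V\<close>, so it lies in \<open>U\<close> and the class of
        \<open>y\<close> lies in \<open>W\<close>.\<close>
      define z where "z = plus A (ominus A y b) a"
      have z: "z \<in> carr A" "(z, y) \<in> mv_cong A I" "e z \<in> V"
        using I y ideal_carr cong_perturb by (simp_all add: z_def e_plus e_ominus)
      then have "e z \<in> e ` U"
        using V(2) by blast
      then have "z \<in> U"
        using z(1) inj_e by (auto simp: U_def inj_on_def)
      then have "q y \<in> W"
        using z y class_eq_iff[of z y] by (simp add: U_def)
      then show "P \<in> h ` W"
        using y by blast
    qed
    moreover have "openin (top_of B.Q) (B.q ` V)"
      using B.open_map_class V(1) by (simp add: open_map_def)
    ultimately show "\<exists>V. openin (top_of B.Q) V \<and> h ` W = V \<inter> h ` carr Q"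
      by metis
  qed
  then have "homeomorphic_map (top_of Q) ?S h"
  proof (rule bijective_open_imp_homeomorphic_map[rotated])
    show "continuous_map (top_of Q) ?S h"
      using h(1) by (simp add: continuous_map_in_subtopology topspace_quotient)
    show "h ` topspace (top_of Q) = topspace ?S"
      using continuous_map_image_subset_topspace[OF h(1)] by (auto simp: topspace_quotient)
  qed (simp add: topspace_quotient inj)
  then have "top_of Q homeomorphic_space ?S"
    by (rule homeomorphic_map_imp_homeomorphic_space)
  then show ?thesis
    using Tychonoff_BQ
    by (simp add: Tychonoff_space_def homeomorphic_completely_regular_space homeomorphic_Hausdorff_space
        completely_regular_space_subtopology Hausdorff_space_subtopology)
qed

end

section \<open>The compactification of the quotient\<close>

context stone_cech_ideal
begin

text \<open>The restriction makes the composite extensional, so that it is literally a coordinate of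
  the cube for \<open>A\<close>.\<close>

definition pull :: "('a set \<Rightarrow> real) \<Rightarrow> 'a \<Rightarrow> real" where
  "pull f = restrict (f \<circ> q) (carr A)"

text \<open>The extension of \<open>q\<close> to the compactifications. It merely selects
  coordinates, which makes its continuity immediate.\<close>

definition \<Psi> :: "(('a \<Rightarrow> real) \<Rightarrow> real) \<Rightarrow> ('a set \<Rightarrow> real) \<Rightarrow> real" where
  "\<Psi> b = (\<lambda>f\<in>unit_functions (top_of Q). b (pull f))"

abbreviation C :: "(('a set \<Rightarrow> real) \<Rightarrow> real) topology" where "C \<equiv> stone_cech (top_of Q)"

lemma pull_unit_function:
  assumes "f \<in> unit_functions (top_of Q)"
  shows "pull f \<in> unit_functions (top_of A)"
proof -
  have "continuous_map (top_of A) (top_of_set {0..1}) (f \<circ> q)"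
    using continuous_map_class assms unfolding unit_functions_def by (blast intro: continuous_map_compose)
  then have "continuous_map (top_of A) (top_of_set {0..1}) (pull f)"
    by (rule continuous_map_eq) (simp add: pull_def topspace_eq)
  then show ?thesis
    by (simp add: unit_functions_def pull_def topspace_eq)
qed

lemma continuous_map_coordinate:
  assumes "g \<in> unit_functions (top_of A)"
  shows "continuous_map (top_of B) (top_of_set {0..1}) (\<lambda>b. b g)"
  unfolding top_B stone_cech_def sc_cube_def
  using assms by (intro continuous_map_from_subtopology continuous_map_product_projection)

lemma e_apply: "x \<in> carr A \<Longrightarrow> f \<in> unit_functions (top_of Q) \<Longrightarrow> e x (pull f) = f (q x)"
  using pull_unit_function[of f] by (simp add: sc_emb_def pull_def)

lemma \<Psi>_e: "x \<in> carr A \<Longrightarrow> \<Psi> (e x) = sc_emb (top_of Q) (q x)"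
  by (auto simp: \<Psi>_def sc_emb_def[of "top_of Q"] e_apply)

lemma continuous_map_\<Psi>_cube: "continuous_map (top_of B) (sc_cube (top_of Q)) \<Psi>"
proof -
  have "continuous_map (top_of B) (top_of_set {0..1}) (\<lambda>b. \<Psi> b f)"
    if "f \<in> unit_functions (top_of Q)" for f
    using continuous_map_coordinate[OF pull_unit_function[OF that]] that by (simp add: \<Psi>_def)
  then show ?thesis
    unfolding sc_cube_def by (auto simp: continuous_map_componentwise \<Psi>_def)
qed

lemma \<Psi>_image_e: "\<Psi> ` e ` carr A = sc_emb (top_of Q) ` topspace (top_of Q)"
proof -
  have "\<Psi> ` e ` carr A = sc_emb (top_of Q) ` q ` carr A"
    unfolding image_image by (rule image_cong) (simp_all add: \<Psi>_e)
  then show ?thesis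
    by (simp only: topspace_quotient carr_quotient)
qed

lemma \<Psi>_onto: "\<Psi> ` carr B = topspace C"
proof
  show "\<Psi> ` carr B \<subseteq> topspace C"
    using continuous_map_image_closure_subset[OF continuous_map_\<Psi>_cube, of "e ` carr A"]
    by (simp add: dense_B \<Psi>_image_e topspace_stone_cech)
  have "compactin (top_of B) (carr B)"
    using compact_B by (simp add: compact_space_def carr_B)
  then have "closedin (sc_cube (top_of Q)) (\<Psi> ` carr B)"
    using compactin_imp_closedin[OF Hausdorff_sc_cube] image_compactin continuous_map_\<Psi>_cube
    by blast
  moreover have "\<Psi> ` e ` carr A \<subseteq> \<Psi> ` carr B"
    by auto
  ultimately show "topspace C \<subseteq> \<Psi> ` carr B"
    by (simp add: topspace_stone_cech closure_of_minimal \<Psi>_image_e[symmetric])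
qed

lemma continuous_map_\<Psi>: "continuous_map (top_of B) C \<Psi>"
  using continuous_map_\<Psi>_cube \<Psi>_onto
  unfolding stone_cech_def by (auto simp: continuous_map_in_subtopology carr_B)

text \<open>For points coming from \<open>A\<close> and \<open>I\<close> the perturbation stays
  within a class, where \<open>pull f\<close> is constant; density in all three variables does the
  rest.\<close>

lemma coordinate_perturb:
  assumes f: "f \<in> unit_functions (top_of Q)" and "p \<in> carr B" "\<alpha> \<in> J" "\<beta> \<in> J"
  shows "plus B (ominus B p \<beta>) \<alpha> (pull f) = p (pull f)"
proof -
  let ?T = "prod_topology (top_of B) (prod_topology (top_of B) (top_of B))"
  let ?g = "\<lambda>t. plus B (ominus B (fst t) (fst (snd t))) (snd (snd t))"
  have "continuous_map ?T (top_of B) ?g"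
    by (intro B.continuous_plus B.continuous_ominus continuous_map_triple)
  note cont = continuous_map_compose[OF _ continuous_map_coordinate[OF pull_unit_function[OF f]]]
  have "((\<lambda>b. b (pull f)) \<circ> ?g) (p, \<beta>, \<alpha>) = ((\<lambda>b. b (pull f)) \<circ> fst) (p, \<beta>, \<alpha>)"
  proof (rule forall_in_closure_of_eq[where f = "(\<lambda>b. b (pull f)) \<circ> ?g"
        and g = "(\<lambda>b. b (pull f)) \<circ> fst"])
    show "(p, \<beta>, \<alpha>) \<in> ?T closure_of (e ` carr A \<times> e ` I \<times> e ` I)"
      using assms unfolding J_def by (intro closure_of_triple) (simp_all add: dense_B)
    show "Hausdorff_space (top_of_set {0..1::real})"
      by (simp add: Hausdorff_space_subtopology)
    show "continuous_map ?T (top_of_set {0..1}) ((\<lambda>b. b (pull f)) \<circ> ?g)"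
      by (rule cont) fact
    show "continuous_map ?T (top_of_set {0..1}) ((\<lambda>b. b (pull f)) \<circ> fst)"
      by (rule cont) (rule continuous_map_triple)
    fix t assume "t \<in> e ` carr A \<times> e ` I \<times> e ` I"
    then obtain x a b where t: "x \<in> carr A" "a \<in> I" "b \<in> I" "t = (e x, e b, e a)"
      by auto
    define y where "y = plus A (ominus A x b) a"
    have y: "y \<in> carr A" "q y = q x"
      using t ideal_carr cong_perturb class_eq_iff by (simp_all add: y_def)
    have "?g t = e y"
      using t ideal_carr by (simp add: y_def e_plus e_ominus)
    then show "((\<lambda>b. b (pull f)) \<circ> ?g) t = ((\<lambda>b. b (pull f)) \<circ> fst) t"
      using e_apply[OF y(1) f] e_apply[OF t(1) f] y(2) t(4) by simp
  qed
  then show ?thesis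
    by simp
qed

lemma \<Psi>_cong:
  assumes "(b, c) \<in> mv_cong B J"
  shows "\<Psi> b = \<Psi> c"
proof -
  obtain \<alpha> \<beta> where "c \<in> carr B" "\<alpha> \<in> J" "\<beta> \<in> J" "b = plus B (ominus B c \<beta>) \<alpha>"
    using assms unfolding B.cong_iff_perturb by blast
  then show ?thesis
    by (auto simp: \<Psi>_def coordinate_perturb)
qed

text \<open>Distinct classes in \<beta>A/J are separated by a continuous \<open>g\<close>.
  Restricted to \<open>A\<close>, it descends to a function on A/I, and the corresponding coordinate
  of \<Psi> already tells the two points apart.\<close>

lemma \<Psi>_eq_imp_cong:
  assumes bc: "b \<in> carr B" "c \<in> carr B" and eq: "\<Psi> b = \<Psi> c"
  shows "(b, c) \<in> mv_cong B J"
proof (rule ccontr)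
  assume "(b, c) \<notin> mv_cong B J"
  then have "B.q b \<noteq> B.q c"
    using bc by (simp add: B.class_eq_iff)
  moreover have "B.q b \<in> topspace (top_of B.Q)" "B.q c \<in> topspace (top_of B.Q)"
    using bc by (simp_all add: B.topspace_quotient B.carr_quotient)
  ultimately have "closedin (top_of B.Q) {B.q c}" "B.q b \<in> topspace (top_of B.Q) - {B.q c}"
    using Hausdorff_BQ by (simp_all add: closedin_Hausdorff_sing_eq)
  then obtain g :: "_ \<Rightarrow> real" where g: "continuous_map (top_of B.Q) (top_of_set {0..1}) g"
      "g (B.q b) = 0" "g ` {B.q c} \<subseteq> {1}"
    using Tychonoff_BQ unfolding Tychonoff_space_def completely_regular_space_def by metis
  have cont: "continuous_map (top_of B) (top_of_set {0..1}) (g \<circ> B.q)"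
    using B.continuous_map_class g(1) by (rule continuous_map_compose)
  have "continuous_map (top_of A) (top_of_set {0..1}) (g \<circ> B.q \<circ> e)"
    using continuous_map_e cont by (rule continuous_map_compose)
  moreover have "(g \<circ> B.q \<circ> e) x = (g \<circ> B.q \<circ> e) y"
    if "x \<in> topspace (top_of A)" "y \<in> topspace (top_of A)" "q x = q y" for x y
  proof -
    have "B.q (e x) = B.q (e y)"
      using that by (simp add: topspace_eq class_eq_iff B.class_eq_iff e_cong_iff)
    then show ?thesis
      by simp
  qed
  ultimately obtain f where f: "continuous_map (top_of Q) (top_of_set {0..1}) f"
      "\<And>x. x \<in> topspace (top_of A) \<Longrightarrow> f (q x) = (g \<circ> B.q \<circ> e) x"
    using quotient_map_lift_exists[OF quotient_map_class] by metis
  \<comment> \<open>Coordinates of the cube must be extensional.\<close>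
  define f' where "f' = restrict f (carr Q)"
  have "continuous_map (top_of Q) (top_of_set {0..1}) f'"
    using f(1) by (rule continuous_map_eq) (simp add: f'_def topspace_quotient)
  then have f': "f' \<in> unit_functions (top_of Q)"
    by (simp add: unit_functions_def f'_def topspace_quotient)
  have ext: "(g \<circ> B.q) p = p (pull f')" if "p \<in> carr B" for p
  proof (rule forall_in_closure_of_eq[OF _ _ cont, where g = "\<lambda>p. p (pull f')"])
    show "p \<in> top_of B closure_of (e ` carr A)"
      using that by (simp add: dense_B)
    show "Hausdorff_space (top_of_set {0..1::real})"
      by (simp add: Hausdorff_space_subtopology)
    show "continuous_map (top_of B) (top_of_set {0..1}) (\<lambda>p. p (pull f'))"
      by (rule continuous_map_coordinate[OF pull_unit_function[OF f']])
    fix p assume "p \<in> e ` carr A"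
    then obtain x where "x \<in> carr A" "p = e x"
      by blast
    then show "(g \<circ> B.q) p = p (pull f')"
      using f(2)[of x] e_apply[OF _ f', of x] by (simp add: f'_def topspace_eq carr_quotient)
  qed
  have "\<Psi> b f' = 0" "\<Psi> c f' = 1"
    using ext bc g(2,3) f' by (simp_all add: \<Psi>_def)
  then show False
    using eq by simp
qed

lemma \<Psi>_eq_iff: "b \<in> carr B \<Longrightarrow> c \<in> carr B \<Longrightarrow> \<Psi> b = \<Psi> c \<longleftrightarrow> B.q b = B.q c"
  using \<Psi>_cong \<Psi>_eq_imp_cong B.class_eq_iff by blast

text \<open>\<Psi> identifies exactly the congruent points, so it induces a continuous bijection,
  and one from a compact space onto a Hausdorff space is a homeomorphism.\<close>

lemma quotient_homeomorphism:
  "\<exists>\<Phi>. homeomorphic_map (top_of B.Q) C \<Phi> \<and> (\<forall>b\<in>carr B. \<Phi> (B.q b) = \<Psi> b)"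
proof -
  have "\<Psi> b = \<Psi> c" if "b \<in> topspace (top_of B)" "c \<in> topspace (top_of B)" "B.q b = B.q c" for b c
    using that \<Psi>_eq_iff by (simp add: carr_B)
  then obtain \<Phi> where \<Phi>: "continuous_map (top_of B.Q) C \<Phi>"
      "\<And>b. b \<in> topspace (top_of B) \<Longrightarrow> \<Phi> (B.q b) = \<Psi> b"
    using quotient_map_lift_exists[OF B.quotient_map_class continuous_map_\<Psi>] by metis
  have \<Phi>q: "\<Phi> (B.q b) = \<Psi> b" if "b \<in> carr B" for b
    using \<Phi>(2) that by (simp add: carr_B)
  have "\<Phi> ` carr B.Q = \<Psi> ` carr B"
    unfolding B.carr_quotient image_image by (rule image_cong) (simp_all add: \<Phi>q)
  moreover have "inj_on \<Phi> (carr B.Q)"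
    by (auto simp: inj_on_def B.carr_quotient \<Phi>q \<Psi>_eq_iff)
  ultimately have "homeomorphic_map (top_of B.Q) C \<Phi>"
    using continuous_imp_homeomorphic_map[OF \<Phi>(1) compact_BQ Hausdorff_stone_cech]
    by (simp add: B.topspace_quotient \<Psi>_onto)
  then show ?thesis
    using \<Phi>q by metis
qed

section \<open>The MV-structure on the compactification of the quotient\<close>

text \<open>The operations of \<beta>A/J, transported along \<Phi> with inverse \<Gamma>, are
  continuous and extend those of A/I. This keeps the isomorphism claim for every such structure from
  being vacuous.\<close>

lemma ex_stone_cech_quotient: "\<exists>D. is_stone_cech_MV Q D"
proof -
  obtain \<Phi> where \<Phi>: "homeomorphic_map (top_of B.Q) C \<Phi>" "\<And>b. b \<in> carr B \<Longrightarrow> \<Phi> (B.q b) = \<Psi> b"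
    using quotient_homeomorphism by metis
  obtain \<Gamma> where \<Gamma>: "continuous_map (top_of B.Q) C \<Phi>" "continuous_map C (top_of B.Q) \<Gamma>"
      "\<And>P. P \<in> carr B.Q \<Longrightarrow> \<Gamma> (\<Phi> P) = P"
    using \<Phi>(1) unfolding homeomorphic_map_maps homeomorphic_maps_def B.topspace_quotient by blast
  interpret BQ: top_mv_algebra B.Q
    by (rule B.top_mv_quotient)
  define D where "D = \<lparr>carr = topspace C, plus = (\<lambda>p r. \<Phi> (plus B.Q (\<Gamma> p) (\<Gamma> r))),
    star = (\<lambda>p. \<Phi> (star B.Q (\<Gamma> p))), zero = \<Phi> (zero B.Q), top_of = C\<rparr>"
  have emb: "sc_emb (top_of Q) (q x) = \<Phi> (B.q (e x))" if "x \<in> carr A" for x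
    using that \<Phi>(2)[of "e x"] by (simp add: \<Psi>_e)
  have \<Gamma>\<Phi>: "\<Gamma> (\<Phi> (B.q b)) = B.q b" if "b \<in> carr B" for b
    using that \<Gamma>(3) by (simp add: B.carr_quotient)
  have "is_stone_cech_MV Q D"
    unfolding is_stone_cech_MV_def
  proof (intro conjI)
    show "top_of D = C" "carr D = topspace C"
      by (simp_all add: D_def)
    let ?CC = "prod_topology C C"
    have "continuous_map ?CC (top_of B.Q) (\<lambda>t. plus B.Q (\<Gamma> (fst t)) (\<Gamma> (snd t)))"
      using continuous_map_compose[OF continuous_map_fst \<Gamma>(2), of C]
        continuous_map_compose[OF continuous_map_snd \<Gamma>(2), of C]
      by (intro BQ.continuous_plus) (simp_all add: o_def)
    from continuous_map_compose[OF this \<Gamma>(1)]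
    show "continuous_map (prod_topology (top_of D) (top_of D)) (top_of D) (\<lambda>(p, r). plus D p r)"
      by (simp add: D_def o_def case_prod_unfold)
    from continuous_map_compose[OF BQ.continuous_star[OF \<Gamma>(2)] \<Gamma>(1)]
    show "continuous_map (top_of D) (top_of D) (star D)"
      by (simp add: D_def o_def)
    show "mv_hom Q D (sc_emb (top_of Q))"
      unfolding mv_hom_def
    proof (intro conjI ballI)
      show "sc_emb (top_of Q) ` carr Q \<subseteq> carr D"
        using sc_emb_subset[of "top_of Q"] by (simp add: D_def topspace_quotient)
      show "sc_emb (top_of Q) (zero Q) = zero D"
        by (simp add: D_def zero_quotient B.zero_quotient emb e_zero)
      show "sc_emb (top_of Q) (star Q P) = star D (sc_emb (top_of Q) P)" if "P \<in> carr Q" for P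
        using that
        by (auto simp: D_def carr_quotient star_quotient B.star_quotient emb e_star \<Gamma>\<Phi>)
      show "sc_emb (top_of Q) (plus Q P R) = plus D (sc_emb (top_of Q) P) (sc_emb (top_of Q) R)"
        if "P \<in> carr Q" "R \<in> carr Q" for P R
        using that
        by (auto simp: D_def carr_quotient plus_quotient B.plus_quotient emb e_plus \<Gamma>\<Phi>)
    qed
  qed
  then show ?thesis ..
qed

lemma hom_\<Psi>:
  assumes D: "is_stone_cech_MV Q D"
  shows "mv_hom B D \<Psi>"
proof -
  have top_D: "top_of D = C" and carr_D: "carr D = topspace C"
    and plus: "continuous_map (prod_topology C C) C (\<lambda>(x, y). plus D x y)"
    and star: "continuous_map C C (star D)" and emb: "mv_hom Q D (sc_emb (top_of Q))"
    using D unfolding is_stone_cech_MV_def by metis+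
  have qQ: "q x \<in> carr Q" if "x \<in> carr A" for x
    using that by (simp add: carr_quotient)
  show ?thesis
    unfolding mv_hom_def
  proof (intro conjI ballI)
    show "\<Psi> ` carr B \<subseteq> carr D"
      by (simp add: \<Psi>_onto carr_D)
    show "\<Psi> (zero B) = zero D"
      using emb \<Psi>_e[of "zero A"] by (simp add: mv_hom_def e_zero zero_quotient)
    show "\<Psi> (star B b) = star D (\<Psi> b)" if "b \<in> carr B" for b
    proof -
      have "(\<Psi> \<circ> star B) b = (star D \<circ> \<Psi>) b"
      proof (rule forall_in_closure_of_eq[where f = "\<Psi> \<circ> star B" and g = "star D \<circ> \<Psi>"])
        show "b \<in> top_of B closure_of (e ` carr A)"
          using that by (simp add: dense_B)
        show "continuous_map (top_of B) C (\<Psi> \<circ> star B)"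
          using B.cont_star continuous_map_\<Psi> by (rule continuous_map_compose)
        show "continuous_map (top_of B) C (star D \<circ> \<Psi>)"
          using continuous_map_\<Psi> star by (rule continuous_map_compose)
        fix b assume "b \<in> e ` carr A"
        then obtain x where x: "x \<in> carr A" "b = e x"
          by blast
        then have "\<Psi> (star B b) = sc_emb (top_of Q) (star Q (q x))"
          using \<Psi>_e[of "star A x"] by (simp add: e_star star_quotient)
        then show "(\<Psi> \<circ> star B) b = (star D \<circ> \<Psi>) b"
          using emb x qQ by (simp add: mv_hom_def \<Psi>_e)
      qed (rule Hausdorff_stone_cech)
      then show ?thesis by simp
    qed
    show "\<Psi> (plus B b c) = plus D (\<Psi> b) (\<Psi> c)" if "b \<in> carr B" "c \<in> carr B" for b c
    proof -
      let ?T = "prod_topology (top_of B) (top_of B)"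
      have "(\<Psi> \<circ> (\<lambda>(x, y). plus B x y)) (b, c) =
        (\<lambda>t. plus D ((\<Psi> \<circ> fst) t) ((\<Psi> \<circ> snd) t)) (b, c)"
      proof (rule forall_in_closure_of_eq[where f = "\<Psi> \<circ> (\<lambda>(x, y). plus B x y)"
            and g = "\<lambda>t. plus D ((\<Psi> \<circ> fst) t) ((\<Psi> \<circ> snd) t)"])
        show "(b, c) \<in> ?T closure_of (e ` carr A \<times> e ` carr A)"
          using that by (simp add: closure_of_Times dense_B)
        show "continuous_map ?T C (\<Psi> \<circ> (\<lambda>(x, y). plus B x y))"
          using B.cont_plus continuous_map_\<Psi> by (rule continuous_map_compose)
        show "continuous_map ?T C (\<lambda>t. plus D ((\<Psi> \<circ> fst) t) ((\<Psi> \<circ> snd) t))"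
          by (intro continuous_map_plus[OF plus] continuous_map_compose[OF _ continuous_map_\<Psi>]
              continuous_map_fst continuous_map_snd)
        fix t assume "t \<in> e ` carr A \<times> e ` carr A"
        then obtain x y where xy: "x \<in> carr A" "y \<in> carr A" "t = (e x, e y)"
          by auto
        then have "\<Psi> (plus B (e x) (e y)) = sc_emb (top_of Q) (plus Q (q x) (q y))"
          using \<Psi>_e[of "plus A x y"] by (simp add: e_plus plus_quotient)
        then show "(\<Psi> \<circ> (\<lambda>(x, y). plus B x y)) t = plus D ((\<Psi> \<circ> fst) t) ((\<Psi> \<circ> snd) t)"
          using emb xy qQ by (simp add: mv_hom_def \<Psi>_e)
      qed (rule Hausdorff_stone_cech)
      then show ?thesis by simp
    qed
  qed
qed

text \<open>The homeomorphism \<Phi> inherits the homomorphism laws from \<Psi>, because every class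
  has a representative and \<open>B.q\<close> respects the operations.\<close>

lemma quotient_iso:
  assumes D: "is_stone_cech_MV Q D"
  shows "top_mv_iso B.Q D"
proof -
  obtain \<Phi> where \<Phi>: "homeomorphic_map (top_of B.Q) C \<Phi>" "\<And>b. b \<in> carr B \<Longrightarrow> \<Phi> (B.q b) = \<Psi> b"
    using quotient_homeomorphism by metis
  have D': "top_of D = C" "carr D = topspace C"
    "continuous_map (prod_topology (top_of D) (top_of D)) (top_of D) (\<lambda>(x, y). plus D x y)"
    "continuous_map (top_of D) (top_of D) (star D)"
    using D unfolding is_stone_cech_MV_def by blast+
  note hom = hom_\<Psi>[OF D]
  interpret BQ: top_mv_algebra B.Q
    by (rule B.top_mv_quotient)
  \<comment> \<open>\<open>is_stone_cech_MV\<close> does not include the MV axioms; they are carried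
    over from \<open>B\<close> by the surjection \<Psi>.\<close>
  have "MV_algebra D"
    using MV_algebra_hom_image[OF B.MV hom] by (simp add: \<Psi>_onto D')
  then have "topological_MV D"
    using D' compact_Hausdorff_imp_Tychonoff[OF compact_stone_cech Hausdorff_stone_cech]
    unfolding topological_MV_def by metis
  moreover have "topological_MV B.Q"
    by (rule BQ.topological_MV[OF Tychonoff_BQ])
  moreover have "mv_hom B.Q D \<Phi>"
    unfolding mv_hom_def
  proof (intro conjI ballI)
    show "\<Phi> ` carr B.Q \<subseteq> carr D"
      using \<Psi>_onto by (auto simp: B.carr_quotient \<Phi>(2) D')
    show "\<Phi> (zero B.Q) = zero D"
      using hom by (simp add: B.zero_quotient \<Phi>(2) mv_hom_def)
    show "\<Phi> (star B.Q P) = star D (\<Phi> P)" if "P \<in> carr B.Q" for P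
      using that hom by (auto simp: B.carr_quotient B.star_quotient \<Phi>(2) mv_hom_def)
    show "\<Phi> (plus B.Q P R) = plus D (\<Phi> P) (\<Phi> R)" if "P \<in> carr B.Q" "R \<in> carr B.Q" for P R
      using that hom by (auto simp: B.carr_quotient B.plus_quotient \<Phi>(2) mv_hom_def)
  qed
  ultimately show ?thesis
    unfolding top_mv_iso_def using \<Phi>(1) D'(1) by auto
qed

lemma pseudocompact_quotient:
  assumes "pseudocompact_space (top_of A)"
  shows "pseudocompact_space (top_of Q)"
  unfolding pseudocompact_space_def
proof (intro conjI allI impI)
  show "Tychonoff_space (top_of Q)"
    by (rule Tychonoff_quotient)
  fix f assume "continuous_map (top_of Q) euclideanreal f"
  then have "continuous_map (top_of A) euclideanreal (f \<circ> q)"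
    using continuous_map_class by (blast intro: continuous_map_compose)
  then have "bounded ((f \<circ> q) ` topspace (top_of A))"
    using assms unfolding pseudocompact_space_def by blast
  then show "bounded (f ` topspace (top_of Q))"
    by (simp add: topspace_quotient carr_quotient topspace_eq image_comp)
qed

end

text \<open>The conjuncts about \<open>mv_quotient A I\<close> secure that \<beta>(A/I) makes sense
  and exists; the isomorphism is then asserted for every structure that qualifies as
  \<beta>(A/I).\<close>

theorem theorem4p11:
  fixes A :: "'a top_mv"
    and I :: "'a set"
    and \<beta>A :: "(('a \<Rightarrow> real) \<Rightarrow> real) top_mv"
    and \<iota>\<^sub>1 :: "'a \<Rightarrow> ('a \<Rightarrow> real) \<Rightarrow> real"
    and J :: "(('a \<Rightarrow> real) \<Rightarrow> real) set"
  assumes "topological_MV A"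
    and "pseudocompact_space (top_of A)"
    and "mv_ideal A I"
    and "closedin (top_of A) I"
    and "is_stone_cech_MV A \<beta>A"
  defines "\<iota>\<^sub>1 \<equiv> sc_emb (top_of A)"
    and "J \<equiv> top_of \<beta>A closure_of (\<iota>\<^sub>1 ` I)"
  shows "mv_ideal \<beta>A J \<and> closedin (top_of \<beta>A) J \<and>
         topological_MV (mv_quotient A I) \<and> pseudocompact_space (top_of (mv_quotient A I)) \<and>
         (\<exists>\<beta>AI. is_stone_cech_MV (mv_quotient A I) \<beta>AI) \<and>
         (\<forall>\<beta>AI. is_stone_cech_MV (mv_quotient A I) \<beta>AI \<longrightarrow>
                top_mv_iso (mv_quotient \<beta>A J) \<beta>AI)"
proof -
  interpret A: top_mv_algebra A
    using assms(1) by (rule topological_MV_imp_top_mv_algebra)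
  interpret S: stone_cech_ideal A I \<beta>A
    using assms(1,3-5) by unfold_locales (simp_all add: topological_MV_def)
  interpret Q: top_mv_algebra S.Q
    by (rule S.top_mv_quotient)
  have J: "J = S.J"
    by (simp add: S.J_def J_def \<iota>\<^sub>1_def)
  show ?thesis
    unfolding J
    using S.ideal_J S.closed_J Q.topological_MV[OF S.Tychonoff_quotient]
      S.pseudocompact_quotient[OF assms(2)] S.ex_stone_cech_quotient S.quotient_iso
    by blast
qed

end
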